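(* Let $H$ be a Hopf algebra with bijective antipode and $A$ a right $H$-comodule transposed Poisson algebra. Assume that there exists an $H$-colinear map $\phi:H\rightarrow A^A$ such that $\phi(1_H)=1_A$. Let $M$ be a transposed Poisson $(A,H)$-Hopf module such that the Lie action and the algebra action on $M$ are associative. (1) Suppose that $H$ is commutative or $\phi$ is an algebra map. If $M$ is injective as a Lie $A$-module, then $M$ is an injective $(\underline{A},H)$-comodule. (2) Suppose that $H$ is commutative. If $M$ is an injective transposed Poisson $A$-module, then $M$ is an injective transposed Poisson $(A,H)$-Hopf module.
   Context: $\mathbf{k}$ is a field of characteristic $0$; all vector spaces, algebras and tensor products are over $\mathbf{k}$. $H$ has comultiplication $\Delta(h)=h_1\otimes h_2$; $H$ is a right $H$-comodule via $\Delta$. Right $H$-coactions are written $m\mapsto m_{(0)}\otimes m_{(1)}$ (implicit sums). Modules over algebras are left unital modules. A transposed Poisson algebra is a commutative associative unital algebra $A$ with a Lie bracket $\{\cdot,\cdot\}$ satisfying $2a\{b,c\}=\{ab,c\}+\{b,ac\}$ for all $a,b,c\in A$. Its transposed Poisson center is $A^A=\{b\in A: b\{a,a'\}=\{ba,a'\}\ \forall a,a'\in A\}$. A right $H$-comodule transposed Poisson algebra is a transposed Poisson algebra $A$ that is a right $H$-comodule algebra (the coaction is a unital algebra map $A\to A\otimes H$) with $\{a,a'\}_{(0)}\otimes\{a,a'\}_{(1)}=\{a_{(0)},a'_{(0)}\}\otimes a_{(1)}a'_{(1)}$ for all $a,a'\in A$. Then $A^A$ is a subalgebra and $H$-subcomodule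 of $A$. A transposed Poisson $A$-module is a vector space $M$ with an $A$-module structure $\cdot$ and a Lie $A$-module structure $\diamond$ (i.e. $\{a,b\}\diamond m=a\diamond(b\diamond m)-b\diamond(a\diamond m)$) such that $2\{a,b\}\cdot m=a\diamond(b\cdot m)-b\diamond(a\cdot m)$ and $2a\cdot(b\diamond m)=(ab)\diamond m+b\diamond(a\cdot m)$ for all $a,b\in A$, $m\in M$. Morphisms are $A$-linear and Lie $A$-linear maps. The Lie action and algebra action on $M$ are associative if $(ab)\diamond m=b\cdot(a\diamond m)$ for all $a\in A$, $b\in A^A$, $m\in M$. An $(\underline{A},H)$-comodule is a vector space $M$ that is a Lie $A$-module and a right $H$-comodule with $(a\diamond m)_{(0)}\otimes(a\diamond m)_{(1)}=a_{(0)}\diamond m_{(0)}\otimes a_{(1)}m_{(1)}$; morphisms are Lie $A$-linear $H$-colinear maps. A transposed Poisson $(A,H)$-Hopf module is a transposed Poisson $A$-module that is also an $(\underline{A},H)$-comodule (with the same Lie action) and satisfies $(a\cdot m)_{(0)}\otimes(a\cdot m)_{(1)}=a_{(0)}\cdot m_{(0)}\otimes a_{(1)}m_{(1)}$; morphisms are $A$-linear, Lie $A$-linear and $H$-colinear maps. "Injective" Lie $A$-module, transposed Poisson $A$-module, $(\underline{A},H)$-comodule, transposed Poisson $(A,H)$-Hopf module means injective object of the corresponding category. *)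

theory Defs
  imports Complex_Main "HOL-Library.Multiset"
begin

section \<open>Tensor products\<close>

text \<open>
  An element of \<open>V \<otimes> H\<close> is written as a formal sum of pure tensors, i.e. a finite multiset of pairs,
  and equality in \<open>V \<otimes> H\<close> is the least congruence on formal sums that makes the pure tensors
  bilinear and \<open>0 \<otimes> h\<close> zero; similarly for \<open>V \<otimes> H \<otimes> H\<close>. Here \<open>V\<close> is a subspace of
  the vector space on \<open>'v\<close> with scalar multiplication \<open>s\<close>, and \<open>H\<close> is all of \<open>'h\<close>.
  A map into a tensor product is given by a choice of representing formal sums, and all
  conditions on it are imposed up to \<open>tensor_eq\<close> or \<open>tensor3_eq\<close>.
\<close>

inductive sum_cong :: "('g multiset \<Rightarrow> 'g multiset \<Rightarrow> bool) \<Rightarrow> 'g multiset \<Rightarrow> 'g multiset \<Rightarrow> bool"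
  for R where
  base: "R x y \<Longrightarrow> sum_cong R x y"
| refl: "sum_cong R x x"
| sym: "sum_cong R x y \<Longrightarrow> sum_cong R y x"
| trans: "sum_cong R x y \<Longrightarrow> sum_cong R y z \<Longrightarrow> sum_cong R x z"
| add: "sum_cong R x y \<Longrightarrow> sum_cong R (x + z) (y + z)"

inductive bilinear_rel ::
  "('k \<Rightarrow> 'v \<Rightarrow> 'v) \<Rightarrow> ('k \<Rightarrow> 'h \<Rightarrow> 'h) \<Rightarrow> 'v::ab_group_add set \<Rightarrow>
   ('v \<times> 'h::ab_group_add) multiset \<Rightarrow> ('v \<times> 'h) multiset \<Rightarrow> bool"
  for s sH V where
  "v \<in> V \<Longrightarrow> v' \<in> V \<Longrightarrow> bilinear_rel s sH V {#(v + v', h)#} {#(v, h), (v', h)#}"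
| "v \<in> V \<Longrightarrow> bilinear_rel s sH V {#(v, h + h')#} {#(v, h), (v, h')#}"
| "v \<in> V \<Longrightarrow> bilinear_rel s sH V {#(s c v, h)#} {#(v, sH c h)#}"
| "bilinear_rel s sH V {#(0, h)#} {#}"

inductive trilinear_rel ::
  "('k \<Rightarrow> 'v \<Rightarrow> 'v) \<Rightarrow> ('k \<Rightarrow> 'h \<Rightarrow> 'h) \<Rightarrow> 'v::ab_group_add set \<Rightarrow>
   ('v \<times> 'h::ab_group_add \<times> 'h) multiset \<Rightarrow> ('v \<times> 'h \<times> 'h) multiset \<Rightarrow> bool"
  for s sH V where
  "v \<in> V \<Longrightarrow> v' \<in> V \<Longrightarrow> trilinear_rel s sH V {#(v + v', h, g)#} {#(v, h, g), (v', h, g)#}"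
| "v \<in> V \<Longrightarrow> trilinear_rel s sH V {#(v, h + h', g)#} {#(v, h, g), (v, h', g)#}"
| "v \<in> V \<Longrightarrow> trilinear_rel s sH V {#(v, h, g + g')#} {#(v, h, g), (v, h, g')#}"
| "v \<in> V \<Longrightarrow> trilinear_rel s sH V {#(s c v, h, g)#} {#(v, sH c h, g)#}"
| "v \<in> V \<Longrightarrow> trilinear_rel s sH V {#(v, sH c h, g)#} {#(v, h, sH c g)#}"
| "trilinear_rel s sH V {#(0, h, g)#} {#}"

definition tensor_eq where "tensor_eq s sH V = sum_cong (bilinear_rel s sH V)"

definition tensor3_eq where "tensor3_eq s sH V = sum_cong (trilinear_rel s sH V)"

text \<open>\<open>(v \<otimes> h, w \<otimes> g) \<mapsto> f v w \<otimes> hg\<close>, extended to formal sums.\<close>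

definition tensor_op ::
  "('v \<Rightarrow> 'w \<Rightarrow> 'x) \<Rightarrow> ('v \<times> 'h::times) multiset \<Rightarrow> ('w \<times> 'h) multiset \<Rightarrow> ('x \<times> 'h) multiset" where
  "tensor_op f x y = (\<Sum>(v, h)\<in>#x. {#(f v w, h * g). (w, g) \<in># y#})"


section \<open>Hopf algebras and comodules\<close>

record ('k, 'h) hopf =
  hscale :: "'k \<Rightarrow> 'h \<Rightarrow> 'h"
  comult :: "'h \<Rightarrow> ('h \<times> 'h) multiset"
  counit :: "'h \<Rightarrow> 'k"
  antipode :: "'h \<Rightarrow> 'h"

definition linear_on ::
  "('k \<Rightarrow> 'v::ab_group_add \<Rightarrow> 'v) \<Rightarrow> 'v set \<Rightarrow> ('k \<Rightarrow> 'w::ab_group_add \<Rightarrow> 'w) \<Rightarrow> 'w set \<Rightarrow>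
   ('v \<Rightarrow> 'w) \<Rightarrow> bool" where
  "linear_on s V t W f \<longleftrightarrow>
     (\<forall>v\<in>V. f v \<in> W) \<and>
     (\<forall>v\<in>V. \<forall>v'\<in>V. f (v + v') = f v + f v') \<and>
     (\<forall>c. \<forall>v\<in>V. f (s c v) = t c (f v))"

definition right_comodule ::
  "('k::field_char_0, 'h::ring_1) hopf \<Rightarrow> ('k \<Rightarrow> 'v::ab_group_add \<Rightarrow> 'v) \<Rightarrow> 'v set \<Rightarrow>
   ('v \<Rightarrow> ('v \<times> 'h) multiset) \<Rightarrow> bool" where
  "right_comodule H s V \<rho> \<longleftrightarrow>
     vector_space s \<and> module.subspace s V \<and>
     (\<forall>v\<in>V. set_mset (\<rho> v) \<subseteq> V \<times> UNIV) \<and>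
     (\<forall>v\<in>V. \<forall>v'\<in>V. tensor_eq s (hscale H) V (\<rho> (v + v')) (\<rho> v + \<rho> v')) \<and>
     (\<forall>c. \<forall>v\<in>V. tensor_eq s (hscale H) V (\<rho> (s c v)) {#(s c x, h). (x, h) \<in># \<rho> v#}) \<and>
     (\<forall>v\<in>V. (\<Sum>(x, h)\<in>#\<rho> v. s (counit H h) x) = v) \<and>
     (\<forall>v\<in>V. tensor3_eq s (hscale H) V
        (\<Sum>(x, h)\<in>#\<rho> v. {#(y, g, h). (y, g) \<in># \<rho> x#})
        (\<Sum>(x, h)\<in>#\<rho> v. {#(x, h1, h2). (h1, h2) \<in># comult H h#}))"

definition colinear ::
  "('k::field_char_0, 'h::ring_1) hopf \<Rightarrow>
   'v set \<Rightarrow> ('v \<Rightarrow> ('v \<times> 'h) multiset) \<Rightarrow>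
   ('k \<Rightarrow> 'w::ab_group_add \<Rightarrow> 'w) \<Rightarrow> 'w set \<Rightarrow> ('w \<Rightarrow> ('w \<times> 'h) multiset) \<Rightarrow>
   ('v \<Rightarrow> 'w) \<Rightarrow> bool" where
  "colinear H V \<rho> t W \<sigma> f \<longleftrightarrow>
     (\<forall>v\<in>V. tensor_eq t (hscale H) W (\<sigma> (f v)) {#(f x, h). (x, h) \<in># \<rho> v#})"

definition algebra_over :: "('k::field \<Rightarrow> 'b::ring \<Rightarrow> 'b) \<Rightarrow> bool" where
  "algebra_over s \<longleftrightarrow> vector_space s \<and>
     (\<forall>c x y. s c x * y = s c (x * y)) \<and> (\<forall>c x y. x * s c y = s c (x * y))"

text \<open>
  Linearity and coassociativity of the comultiplication and one half of the counit law say
  precisely that \<open>H\<close> is a right comodule over itself via the comultiplication.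
\<close>

definition hopf_algebra :: "('k::field_char_0, 'h::ring_1) hopf \<Rightarrow> bool" where
  "hopf_algebra H \<longleftrightarrow>
     algebra_over (hscale H) \<and>
     right_comodule H (hscale H) UNIV (comult H) \<and>
     (\<forall>h. (\<Sum>(x, y)\<in>#comult H h. hscale H (counit H x) y) = h) \<and>
     tensor_eq (hscale H) (hscale H) UNIV (comult H 1) {#(1, 1)#} \<and>
     (\<forall>h g. tensor_eq (hscale H) (hscale H) UNIV
        (comult H (h * g)) (tensor_op (*) (comult H h) (comult H g))) \<and>
     Vector_Spaces.linear (hscale H) (*) (counit H) \<and>
     counit H 1 = 1 \<and> (\<forall>h g. counit H (h * g) = counit H h * counit H g) \<and>
     Vector_Spaces.linear (hscale H) (hscale H) (antipode H) \<and>
     (\<forall>h. (\<Sum>(x, y)\<in>#comult H h. antipode H x * y) = hscale H (counit H h) 1) \<and>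
     (\<forall>h. (\<Sum>(x, y)\<in>#comult H h. x * antipode H y) = hscale H (counit H h) 1)"


section \<open>Transposed Poisson algebras\<close>

text \<open>
  The sort of \<open>'a\<close> describes commutative unital rings, the zero ring included
  (class \<open>comm_ring_1\<close> would exclude it). It provides no numerals, hence the scalar \<open>2\<close> below.
\<close>

record ('k, 'a, 'h) tp_alg =
  ascale :: "'k \<Rightarrow> 'a \<Rightarrow> 'a"
  bracket :: "'a \<Rightarrow> 'a \<Rightarrow> 'a"
  acoact :: "'a \<Rightarrow> ('a \<times> 'h) multiset"

definition transposed_poisson_algebra ::
  "('k::field_char_0, 'a::{comm_ring, comm_monoid_mult}, 'h) tp_alg \<Rightarrow> bool" where
  "transposed_poisson_algebra A \<longleftrightarrow>
     algebra_over (ascale A) \<and>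
     (\<forall>a. Vector_Spaces.linear (ascale A) (ascale A) (bracket A a)) \<and>
     (\<forall>b. Vector_Spaces.linear (ascale A) (ascale A) (\<lambda>a. bracket A a b)) \<and>
     (\<forall>a. bracket A a a = 0) \<and>
     (\<forall>a b c. bracket A a (bracket A b c) + bracket A b (bracket A c a)
              + bracket A c (bracket A a b) = 0) \<and>
     (\<forall>a b c. ascale A 2 (a * bracket A b c) = bracket A (a * b) c + bracket A b (a * c))"

definition tp_center :: "('k, 'a::times, 'h) tp_alg \<Rightarrow> 'a set" where
  "tp_center A = {b. \<forall>a a'. b * bracket A a a' = bracket A (b * a) a'}"

definition comodule_tp_algebra ::
  "('k::field_char_0, 'h::ring_1) hopf \<Rightarrow>
   ('k, 'a::{comm_ring, comm_monoid_mult}, 'h) tp_alg \<Rightarrow> bool" where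
  "comodule_tp_algebra H A \<longleftrightarrow>
     transposed_poisson_algebra A \<and>
     right_comodule H (ascale A) UNIV (acoact A) \<and>
     tensor_eq (ascale A) (hscale H) UNIV (acoact A 1) {#(1, 1)#} \<and>
     (\<forall>a b. tensor_eq (ascale A) (hscale H) UNIV
        (acoact A (a * b)) (tensor_op (*) (acoact A a) (acoact A b))) \<and>
     (\<forall>a b. tensor_eq (ascale A) (hscale H) UNIV
        (acoact A (bracket A a b)) (tensor_op (bracket A) (acoact A a) (acoact A b)))"


section \<open>Modules\<close>

text \<open>
  One record type serves the four categories below. Each of them looks only at the fields that
  belong to its structure, so the forgetful functors are the identity on records. The underlying
  vector space is the subspace \<open>carr\<close> of the vector space on \<open>'v\<close> given by \<open>scale\<close>.
\<close>

record ('k, 'a, 'h, 'v) tp_mod =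
  carr :: "'v set"
  scale :: "'k \<Rightarrow> 'v \<Rightarrow> 'v"
  act :: "'a \<Rightarrow> 'v \<Rightarrow> 'v"
  lact :: "'a \<Rightarrow> 'v \<Rightarrow> 'v"
  coact :: "'v \<Rightarrow> ('v \<times> 'h) multiset"

definition bilinear_action ::
  "('k::field \<Rightarrow> 'a::ab_group_add \<Rightarrow> 'a) \<Rightarrow> ('k \<Rightarrow> 'v::ab_group_add \<Rightarrow> 'v) \<Rightarrow> 'v set \<Rightarrow>
   ('a \<Rightarrow> 'v \<Rightarrow> 'v) \<Rightarrow> bool" where
  "bilinear_action sA s V f \<longleftrightarrow>
     (\<forall>a. linear_on s V s V (f a)) \<and> (\<forall>m\<in>V. linear_on sA UNIV s V (\<lambda>a. f a m))"

definition lie_module ::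
  "('k::field_char_0, 'a::{comm_ring, comm_monoid_mult}, 'h) tp_alg \<Rightarrow>
   ('k, 'a, 'h, 'v::ab_group_add) tp_mod \<Rightarrow> bool" where
  "lie_module A M \<longleftrightarrow>
     vector_space (scale M) \<and> module.subspace (scale M) (carr M) \<and>
     bilinear_action (ascale A) (scale M) (carr M) (lact M) \<and>
     (\<forall>a b. \<forall>m\<in>carr M.
        lact M (bracket A a b) m = lact M a (lact M b m) - lact M b (lact M a m))"

definition tp_module ::
  "('k::field_char_0, 'a::{comm_ring, comm_monoid_mult}, 'h) tp_alg \<Rightarrow>
   ('k, 'a, 'h, 'v::ab_group_add) tp_mod \<Rightarrow> bool" where
  "tp_module A M \<longleftrightarrow>
     lie_module A M \<and>
     bilinear_action (ascale A) (scale M) (carr M) (act M) \<and>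
     (\<forall>m\<in>carr M. act M 1 m = m) \<and>
     (\<forall>a b. \<forall>m\<in>carr M. act M (a * b) m = act M a (act M b m)) \<and>
     (\<forall>a b. \<forall>m\<in>carr M. scale M 2 (act M (bracket A a b) m)
        = lact M a (act M b m) - lact M b (act M a m)) \<and>
     (\<forall>a b. \<forall>m\<in>carr M. scale M 2 (act M a (lact M b m))
        = lact M (a * b) m + lact M b (act M a m))"

definition associative_actions ::
  "('k, 'a::times, 'h) tp_alg \<Rightarrow> ('k, 'a, 'h, 'v) tp_mod \<Rightarrow> bool" where
  "associative_actions A M \<longleftrightarrow>
     (\<forall>a. \<forall>b\<in>tp_center A. \<forall>m\<in>carr M. lact M (a * b) m = act M b (lact M a m))"

definition lie_comodule ::
  "('k::field_char_0, 'h::ring_1) hopf \<Rightarrow>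
   ('k, 'a::{comm_ring, comm_monoid_mult}, 'h) tp_alg \<Rightarrow>
   ('k, 'a, 'h, 'v::ab_group_add) tp_mod \<Rightarrow> bool" where
  "lie_comodule H A M \<longleftrightarrow>
     lie_module A M \<and>
     right_comodule H (scale M) (carr M) (coact M) \<and>
     (\<forall>a. \<forall>m\<in>carr M. tensor_eq (scale M) (hscale H) (carr M)
        (coact M (lact M a m)) (tensor_op (lact M) (acoact A a) (coact M m)))"

definition tp_hopf_module ::
  "('k::field_char_0, 'h::ring_1) hopf \<Rightarrow>
   ('k, 'a::{comm_ring, comm_monoid_mult}, 'h) tp_alg \<Rightarrow>
   ('k, 'a, 'h, 'v::ab_group_add) tp_mod \<Rightarrow> bool" where
  "tp_hopf_module H A M \<longleftrightarrow>
     tp_module A M \<and> lie_comodule H A M \<and>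
     (\<forall>a. \<forall>m\<in>carr M. tensor_eq (scale M) (hscale H) (carr M)
        (coact M (act M a m)) (tensor_op (act M) (acoact A a) (coact M m)))"


section \<open>Morphisms\<close>

text \<open>A morphism is a function considered on the carrier of its source only.\<close>

definition lie_hom ::
  "('k, 'a, 'h, 'v::ab_group_add) tp_mod \<Rightarrow> ('k, 'a, 'h, 'w::ab_group_add) tp_mod \<Rightarrow>
   ('v \<Rightarrow> 'w) \<Rightarrow> bool" where
  "lie_hom M N f \<longleftrightarrow>
     linear_on (scale M) (carr M) (scale N) (carr N) f \<and>
     (\<forall>a. \<forall>m\<in>carr M. f (lact M a m) = lact N a (f m))"

definition tp_hom ::
  "('k, 'a, 'h, 'v::ab_group_add) tp_mod \<Rightarrow> ('k, 'a, 'h, 'w::ab_group_add) tp_mod \<Rightarrow>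
   ('v \<Rightarrow> 'w) \<Rightarrow> bool" where
  "tp_hom M N f \<longleftrightarrow> lie_hom M N f \<and> (\<forall>a. \<forall>m\<in>carr M. f (act M a m) = act N a (f m))"

definition lie_comodule_hom ::
  "('k::field_char_0, 'h::ring_1) hopf \<Rightarrow>
   ('k, 'a, 'h, 'v::ab_group_add) tp_mod \<Rightarrow> ('k, 'a, 'h, 'w::ab_group_add) tp_mod \<Rightarrow>
   ('v \<Rightarrow> 'w) \<Rightarrow> bool" where
  "lie_comodule_hom H M N f \<longleftrightarrow>
     lie_hom M N f \<and> colinear H (carr M) (coact M) (scale N) (carr N) (coact N) f"

definition tp_hopf_hom ::
  "('k::field_char_0, 'h::ring_1) hopf \<Rightarrow>
   ('k, 'a, 'h, 'v::ab_group_add) tp_mod \<Rightarrow> ('k, 'a, 'h, 'w::ab_group_add) tp_mod \<Rightarrow>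
   ('v \<Rightarrow> 'w) \<Rightarrow> bool" where
  "tp_hopf_hom H M N f \<longleftrightarrow>
     tp_hom M N f \<and> colinear H (carr M) (coact M) (scale N) (carr N) (coact N) f"


section \<open>Injective objects\<close>

text \<open>
  \<open>Obj\<close> and \<open>Hom\<close> describe a category of modules carried by the type \<open>'u\<close>; \<open>HomM X\<close> is the set of
  morphisms from such an \<open>X\<close> to the fixed object whose injectivity is tested. HOL cannot
  quantify over all types inside a formula, so injectivity is relative to the type \<open>'u\<close> of the
  test objects (as with universe levels); being injective means being so for every \<open>'u\<close>.
\<close>

definition mono_in ::
  "(('k, 'a, 'h, 'u) tp_mod \<Rightarrow> bool) \<Rightarrow>
   (('k, 'a, 'h, 'u) tp_mod \<Rightarrow> ('k, 'a, 'h, 'u) tp_mod \<Rightarrow> ('u \<Rightarrow> 'u) \<Rightarrow> bool) \<Rightarrow>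
   ('k, 'a, 'h, 'u) tp_mod \<Rightarrow> ('k, 'a, 'h, 'u) tp_mod \<Rightarrow> ('u \<Rightarrow> 'u) \<Rightarrow> bool" where
  "mono_in Obj Hom X Y i \<longleftrightarrow>
     Hom X Y i \<and>
     (\<forall>Z p q. Obj Z \<and> Hom Z X p \<and> Hom Z X q \<and> (\<forall>z\<in>carr Z. i (p z) = i (q z))
        \<longrightarrow> (\<forall>z\<in>carr Z. p z = q z))"

definition extends_along_monos ::
  "(('k, 'a, 'h, 'u) tp_mod \<Rightarrow> bool) \<Rightarrow>
   (('k, 'a, 'h, 'u) tp_mod \<Rightarrow> ('k, 'a, 'h, 'u) tp_mod \<Rightarrow> ('u \<Rightarrow> 'u) \<Rightarrow> bool) \<Rightarrow>
   (('k, 'a, 'h, 'u) tp_mod \<Rightarrow> ('u \<Rightarrow> 'm) \<Rightarrow> bool) \<Rightarrow> bool" where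
  "extends_along_monos Obj Hom HomM \<longleftrightarrow>
     (\<forall>X Y i f. Obj X \<and> Obj Y \<and> mono_in Obj Hom X Y i \<and> HomM X f
        \<longrightarrow> (\<exists>g. HomM Y g \<and> (\<forall>x\<in>carr X. g (i x) = f x)))"

definition injective_lie_module ::
  "'u::ab_group_add itself \<Rightarrow>
   ('k::field_char_0, 'a::{comm_ring, comm_monoid_mult}, 'h) tp_alg \<Rightarrow>
   ('k, 'a, 'h, 'm::ab_group_add) tp_mod \<Rightarrow> bool" where
  "injective_lie_module (_ :: 'u itself) A M \<longleftrightarrow>
     lie_module A M \<and>
     extends_along_monos (lie_module A) lie_hom
       (\<lambda>X :: ('k, 'a, 'h, 'u) tp_mod. lie_hom X M)"

definition injective_tp_module ::
  "'u::ab_group_add itself \<Rightarrow>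
   ('k::field_char_0, 'a::{comm_ring, comm_monoid_mult}, 'h) tp_alg \<Rightarrow>
   ('k, 'a, 'h, 'm::ab_group_add) tp_mod \<Rightarrow> bool" where
  "injective_tp_module (_ :: 'u itself) A M \<longleftrightarrow>
     tp_module A M \<and>
     extends_along_monos (tp_module A) tp_hom
       (\<lambda>X :: ('k, 'a, 'h, 'u) tp_mod. tp_hom X M)"

definition injective_lie_comodule ::
  "'u::ab_group_add itself \<Rightarrow> ('k::field_char_0, 'h::ring_1) hopf \<Rightarrow>
   ('k, 'a::{comm_ring, comm_monoid_mult}, 'h) tp_alg \<Rightarrow>
   ('k, 'a, 'h, 'm::ab_group_add) tp_mod \<Rightarrow> bool" where
  "injective_lie_comodule (_ :: 'u itself) H A M \<longleftrightarrow>
     lie_comodule H A M \<and>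
     extends_along_monos (lie_comodule H A) (lie_comodule_hom H)
       (\<lambda>X :: ('k, 'a, 'h, 'u) tp_mod. lie_comodule_hom H X M)"

definition injective_tp_hopf_module ::
  "'u::ab_group_add itself \<Rightarrow> ('k::field_char_0, 'h::ring_1) hopf \<Rightarrow>
   ('k, 'a::{comm_ring, comm_monoid_mult}, 'h) tp_alg \<Rightarrow>
   ('k, 'a, 'h, 'm::ab_group_add) tp_mod \<Rightarrow> bool" where
  "injective_tp_hopf_module (_ :: 'u itself) H A M \<longleftrightarrow>
     tp_hopf_module H A M \<and>
     extends_along_monos (tp_hopf_module H A) (tp_hopf_hom H)
       (\<lambda>X :: ('k, 'a, 'h, 'u) tp_mod. tp_hopf_hom H X M)"

end

theory Submission
  imports Defs
begin

text \<open>
  Suppose that \<open>M\<close> is injective after forgetting the coaction. A monomorphism \<open>i\<close> of comodules is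
  injective, because the kernel of a linear colinear map is a subobject; so it is still a monomorphism
  after forgetting, and a morphism \<open>f : X \<rightarrow> M\<close> extends along \<open>i : X \<rightarrow> Y\<close> to a map
  \<open>g : Y \<rightarrow> M\<close> that respects the actions but need not be colinear. The idea is to average \<open>g\<close>
  over \<open>H\<close>. With \<open>T\<close> the inverse of the antipode, the total integral \<open>\<phi>\<close> gives a map
    \<open>avg : M \<otimes> H \<rightarrow> M\<close>, \<open>avg(m \<otimes> h) = \<phi>(h T(m\<^sub>1)) \<cdot> m\<^sub>0\<close>,
  which is colinear for the coaction \<open>m \<otimes> h \<mapsto> m \<otimes> h\<^sub>1 \<otimes> h\<^sub>2\<close> (lemma \<open>avg_colinear\<close>, because
  \<open>T\<close> reverses the comultiplication and \<open>T(m\<^sub>2) m\<^sub>1 = \<epsilon>(m)\<close>) and splits the coaction of \<open>M\<close> (lemma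
  \<open>avg_retraction\<close>, because \<open>m\<^sub>2 T(m\<^sub>1) = \<epsilon>(m)\<close> and \<open>\<phi>(1) = 1\<close>).
  Hence \<open>y \<mapsto> avg(g(y\<^sub>0) \<otimes> y\<^sub>1)\<close> is colinear and still extends \<open>f\<close>.

  It also respects the actions (lemma \<open>avg_equivariant\<close>). Applying \<open>avg\<close> to
  \<open>a\<^sub>0 m \<otimes> a\<^sub>1 h\<close> produces \<open>\<phi>(a\<^sub>2 h T(m\<^sub>1) T(a\<^sub>1)) \<cdot> (a\<^sub>0 m\<^sub>0)\<close>, in which \<open>a\<^sub>1\<close> and \<open>a\<^sub>2\<close>
  cancel if \<open>H\<close> is commutative, or if \<open>\<phi>\<close> is multiplicative, since \<open>A\<close> is commutative (lemma
  \<open>phi_ad_invariant\<close>). What remains is that acting by \<open>\<phi>(x)\<close> commutes with both actions of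
  \<open>A\<close> on \<open>M\<close>; for the Lie action this follows from the associativity hypothesis, as
  \<open>\<phi>(x)\<close> is in the transposed Poisson center (lemma \<open>lact_act_commute\<close>).

  Elements of tensor products are formal sums modulo a congruence, so two translations are needed.
  A multilinear expression takes equal values on congruent formal sums (lemmas \<open>tensor_eq_tsum\<close>
  and \<open>tensor3_eq_eval\<close>); this turns every axiom into an identity for arbitrary multilinear
  \<open>F\<close>, and Sweedler computations become chains of such identities between iterated sums.
  Conversely, as \<open>H\<close> has a basis, formal sums on which all functionals of \<open>H\<close> agree are
  congruent (lemmas \<open>tensor_eqI\<close> and \<open>tensor3_eqI\<close>). This criterion does not mention the subspace
  \<open>V\<close> in \<open>V \<otimes> H\<close>, which is why kernels of colinear maps inherit a coaction.
\<close>

section \<open>Evaluating formal sums\<close>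

text \<open>The value of the map \<open>v \<otimes> h \<mapsto> F v h\<close> on a formal sum: with \<open>x = \<rho> m\<close> this is \<open>F m\<^sub>0 m\<^sub>1\<close> in
  Sweedler notation.\<close>

definition tsum :: "('v \<times> 'h) multiset \<Rightarrow> ('v \<Rightarrow> 'h \<Rightarrow> 'w) \<Rightarrow> 'w::comm_monoid_add" where
  "tsum x F = (\<Sum>(v, h)\<in>#x. F v h)"

lemma tsum_empty [simp]: "tsum {#} F = 0"
  and tsum_add_mset [simp]: "tsum (add_mset (v, h) x) F = F v h + tsum x F"
  and tsum_union [simp]: "tsum (x + y) F = tsum x F + tsum y F"
  by (simp_all add: tsum_def)

lemma tsum_cong:
  assumes "x = y" and "\<And>v h. (v, h) \<in># y \<Longrightarrow> F v h = G v h"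
  shows "tsum x F = tsum y G"
  unfolding tsum_def assms(1)
  by (intro arg_cong[of _ _ sum_mset] image_mset_cong) (use assms(2) in auto)

lemma tsum_swap:
  "tsum x (\<lambda>v h. tsum y (\<lambda>w g. F v h w g)) = tsum y (\<lambda>w g. tsum x (\<lambda>v h. F v h w g))"
  unfolding tsum_def split_def by (rule sum_mset.swap)

lemma tsum_add: "tsum x (\<lambda>v h. F v h + G v h) = tsum x F + tsum x G"
  unfolding tsum_def split_def by (rule sum_mset.distrib)

lemma tsum_image [simp]:
  "tsum {#(f v h, g v h). (v, h) \<in># x#} F = tsum x (\<lambda>v h. F (f v h) (g v h))"
  by (induction x) auto

lemma tsum_tensor_op:
  "tsum (tensor_op f x y) F = tsum x (\<lambda>v h. tsum y (\<lambda>w g. F (f v w) (h * g)))"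
  by (induction x) (auto simp: tensor_op_def)

lemma tensor_op_mem:
  assumes "(x, h) \<in># tensor_op f p q"
  obtains v g w k where "(v, g) \<in># p" "(w, k) \<in># q" "x = f v w"
  using assms unfolding tensor_op_def by auto


section \<open>Linear and multilinear maps on carriers\<close>

text \<open>\<open>V\<close> is a subspace of the vector space given by \<open>s\<close>.\<close>

definition vsub :: "('k::field \<Rightarrow> 'v::ab_group_add \<Rightarrow> 'v) \<Rightarrow> 'v set \<Rightarrow> bool" where
  "vsub s V \<longleftrightarrow> vector_space s \<and> module.subspace s V"

lemma vsubD:
  assumes "vsub s V"
  shows "0 \<in> V" and "v \<in> V \<Longrightarrow> w \<in> V \<Longrightarrow> v + w \<in> V" and "v \<in> V \<Longrightarrow> s c v \<in> V"
    and "s c (v + w) = s c v + s c w" and "s (c + d) v = s c v + s d v"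
    and "s c (s d v) = s (c * d) v" and "s 1 v = v" and "s 0 v = 0" and "s c 0 = 0"
    and "s c (v - w) = s c v - s c w"
proof -
  interpret vector_space s using assms by (simp add: vsub_def)
  have *: "subspace V" using assms by (simp add: vsub_def)
  show "0 \<in> V" "v \<in> V \<Longrightarrow> w \<in> V \<Longrightarrow> v + w \<in> V" "v \<in> V \<Longrightarrow> s c v \<in> V"
    using * by (auto simp: subspace_def)
  show "s c (v + w) = s c v + s c w" "s (c + d) v = s c v + s d v"
    "s c (s d v) = s (c * d) v" "s 1 v = v" "s 0 v = 0" "s c 0 = 0"
    "s c (v - w) = s c v - s c w"
    by (simp_all add: algebra_simps)
qed

lemma vsub_UNIV: "vector_space s \<Longrightarrow> vsub s UNIV"
  unfolding vsub_def using module.subspace_UNIV module_iff_vector_space by blast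

lemma linear_onI:
  assumes "\<And>v. v \<in> V \<Longrightarrow> f v \<in> W" "\<And>v w. v \<in> V \<Longrightarrow> w \<in> V \<Longrightarrow> f (v + w) = f v + f w"
    "\<And>c v. v \<in> V \<Longrightarrow> f (s c v) = t c (f v)"
  shows "linear_on s V t W f"
  using assms by (auto simp: linear_on_def)

lemma linear_onD:
  assumes "linear_on s V t W f"
  shows "v \<in> V \<Longrightarrow> f v \<in> W" "v \<in> V \<Longrightarrow> w \<in> V \<Longrightarrow> f (v + w) = f v + f w"
    "v \<in> V \<Longrightarrow> f (s c v) = t c (f v)"
  using assms by (auto simp: linear_on_def)

lemma linear_on_0:
  assumes "linear_on s V t W f" "0 \<in> V" shows "f 0 = 0"
  using linear_onD(2)[OF assms(1), of 0 0] assms(2) by simp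

lemma linear_on_UNIV:
  assumes "Vector_Spaces.linear s t f" shows "linear_on s UNIV t UNIV f"
proof -
  interpret Vector_Spaces.linear s t f by fact
  show ?thesis by (auto simp: linear_on_def add scale)
qed

lemma linear_on_comp:
  assumes "linear_on t W u U g" "linear_on s V t W f"
  shows "linear_on s V u U (\<lambda>v. g (f v))"
  using assms by (auto simp: linear_on_def)

lemma tsum_in:
  assumes "vsub t W" "\<And>v h. (v, h) \<in># x \<Longrightarrow> F v h \<in> W"
  shows "tsum x F \<in> W"
  using assms(2) by (induction x) (auto simp: vsubD(1,2)[OF assms(1)])

lemma linear_on_tsum:
  assumes "linear_on s V t W L" "vsub s V" "\<And>v h. (v, h) \<in># x \<Longrightarrow> F v h \<in> V"
  shows "L (tsum x F) = tsum x (\<lambda>v h. L (F v h))"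
  using assms(3)
proof (induction x)
  case empty
  show ?case using linear_on_0[OF assms(1)] vsubD(1)[OF assms(2)] by simp
next
  case (add z x)
  obtain v h where z: "z = (v, h)" by (cases z)
  have "tsum x F \<in> V" by (rule tsum_in[OF assms(2)]) (use add.prems in auto)
  then show ?case using add linear_onD(2)[OF assms(1)] by (auto simp: z)
qed

lemma tsum_linear:
  assumes "vsub t W" "\<And>a b. (a, b) \<in># x \<Longrightarrow> linear_on s V t W (\<lambda>v. F v a b)"
  shows "linear_on s V t W (\<lambda>v. tsum x (F v))"
proof (rule linear_onI)
  note lin = linear_onD[OF assms(2)]
  show "tsum x (F v) \<in> W" if "v \<in> V" for v
    by (rule tsum_in[OF assms(1)]) (rule lin(1)[OF _ that])
  show "tsum x (F (v + w)) = tsum x (F v) + tsum x (F w)" if "v \<in> V" "w \<in> V" for v w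
    unfolding tsum_add[symmetric] by (rule tsum_cong[OF HOL.refl]) (rule lin(2)[OF _ that])
  show "tsum x (F (s c v)) = t c (tsum x (F v))" if v: "v \<in> V" for v c
  proof -
    have "linear_on t W t W (t c)"
      by (rule linear_onI) (simp_all add: vsubD[OF assms(1)] mult.commute)
    then have "t c (tsum x (F v)) = tsum x (\<lambda>a b. t c (F v a b))"
      by (rule linear_on_tsum[OF _ assms(1)]) (rule lin(1)[OF _ v])
    also have "\<dots> = tsum x (F (s c v))"
      by (rule tsum_cong[OF HOL.refl]) (rule lin(3)[OF _ v, symmetric])
    finally show ?thesis by simp
  qed
qed

text \<open>\<open>F\<close> is bilinear from \<open>V \<times> H\<close>, respectively trilinear from \<open>V \<times> H \<times> H\<close>, to \<open>W\<close>. Only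
  the first argument is restricted to a subspace; the others range over the whole type.\<close>

definition bilin ::
  "('k \<Rightarrow> 'v::ab_group_add \<Rightarrow> 'v) \<Rightarrow> 'v set \<Rightarrow> ('k \<Rightarrow> 'h::ab_group_add \<Rightarrow> 'h) \<Rightarrow>
   ('k \<Rightarrow> 'w::ab_group_add \<Rightarrow> 'w) \<Rightarrow> 'w set \<Rightarrow> ('v \<Rightarrow> 'h \<Rightarrow> 'w) \<Rightarrow> bool" where
  "bilin s V sH t W F \<longleftrightarrow>
     (\<forall>h. linear_on s V t W (\<lambda>v. F v h)) \<and> (\<forall>v\<in>V. linear_on sH UNIV t W (F v))"

definition trilin ::
  "('k \<Rightarrow> 'v::ab_group_add \<Rightarrow> 'v) \<Rightarrow> 'v set \<Rightarrow> ('k \<Rightarrow> 'h::ab_group_add \<Rightarrow> 'h) \<Rightarrow>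
   ('k \<Rightarrow> 'w::ab_group_add \<Rightarrow> 'w) \<Rightarrow> 'w set \<Rightarrow> ('v \<Rightarrow> 'h \<Rightarrow> 'h \<Rightarrow> 'w) \<Rightarrow> bool" where
  "trilin s V sH t W F \<longleftrightarrow>
     (\<forall>h g. linear_on s V t W (\<lambda>v. F v h g)) \<and>
     (\<forall>v\<in>V. \<forall>g. linear_on sH UNIV t W (\<lambda>h. F v h g)) \<and>
     (\<forall>v\<in>V. \<forall>h. linear_on sH UNIV t W (F v h))"

lemma bilinI:
  assumes "\<And>h. linear_on s V t W (\<lambda>v. F v h)" "\<And>v. v \<in> V \<Longrightarrow> linear_on sH UNIV t W (\<lambda>h. F v h)"
  shows "bilin s V sH t W F"
  using assms by (simp add: bilin_def)

lemma bilinD: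
  assumes "bilin s V sH t W F"
  shows "linear_on s V t W (\<lambda>v. F v h)" "v \<in> V \<Longrightarrow> linear_on sH UNIV t W (F v)"
    "v \<in> V \<Longrightarrow> F v h \<in> W"
  using assms by (auto simp: bilin_def linear_on_def)

lemma trilinI:
  assumes "\<And>h g. linear_on s V t W (\<lambda>v. F v h g)"
    "\<And>v g. v \<in> V \<Longrightarrow> linear_on sH UNIV t W (\<lambda>h. F v h g)"
    "\<And>v h. v \<in> V \<Longrightarrow> linear_on sH UNIV t W (\<lambda>g. F v h g)"
  shows "trilin s V sH t W F"
  using assms by (simp add: trilin_def)

lemma trilinD:
  assumes "trilin s V sH t W F"
  shows "linear_on s V t W (\<lambda>v. F v h g)" "v \<in> V \<Longrightarrow> linear_on sH UNIV t W (\<lambda>h. F v h g)"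
    "v \<in> V \<Longrightarrow> linear_on sH UNIV t W (\<lambda>g. F v h g)"
  using assms by (auto simp: trilin_def)


section \<open>Equality in a tensor product is detected by functionals\<close>

lemma sum_cong_eval:
  assumes "sum_cong R x y" "\<And>x y. R x y \<Longrightarrow> sum_mset (image_mset f x) = sum_mset (image_mset f y)"
  shows "sum_mset (image_mset f x) = sum_mset (image_mset f y)"
  using assms(1) by induction (erule assms(2) | simp)+

lemma tensor_eq_tsum:
  assumes eq: "tensor_eq s sH V x y" and F: "bilin s V sH t W F" and V: "vsub s V"
  shows "tsum x F = tsum y F"
  unfolding tsum_def
proof (rule sum_cong_eval[OF eq[unfolded tensor_eq_def]])
  have 0: "F 0 h = 0" for h
    using linear_on_0[OF bilinD(1)[OF F]] vsubD(1)[OF V] by simp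
  note lin = linear_onD(2,3)[OF bilinD(1)[OF F]] linear_onD(2,3)[OF bilinD(2)[OF F]]
  fix x y assume "bilinear_rel s sH V x y"
  then show "(\<Sum>(v, h)\<in>#x. F v h) = (\<Sum>(v, h)\<in>#y. F v h)"
    by cases (simp_all add: lin 0)
qed

lemma tensor3_eq_eval:
  assumes eq: "tensor3_eq s sH V x y" and F: "trilin s V sH t W F" and V: "vsub s V"
  shows "(\<Sum>(v, h, g)\<in>#x. F v h g) = (\<Sum>(v, h, g)\<in>#y. F v h g)"
proof (rule sum_cong_eval[OF eq[unfolded tensor3_eq_def]])
  have 0: "F 0 h g = 0" for h g
    using linear_on_0[OF trilinD(1)[OF F]] vsubD(1)[OF V] by simp
  note lin = linear_onD(2,3)[OF trilinD(1)[OF F]] linear_onD(2,3)[OF trilinD(2)[OF F]]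
    linear_onD(2,3)[OF trilinD(3)[OF F]]
  fix x y assume "trilinear_rel s sH V x y"
  then show "(\<Sum>(v, h, g)\<in>#x. F v h g) = (\<Sum>(v, h, g)\<in>#y. F v h g)"
    by cases (simp_all add: lin 0)
qed

lemma sum_cong_union:
  assumes "sum_cong R x y" "sum_cong R x' y'"
  shows "sum_cong R (x + x') (y + y')"
proof -
  have "sum_cong R (x + x') (y + x')" using assms(1) by (rule sum_cong.add)
  moreover have "sum_cong R (x' + y) (y' + y)" using assms(2) by (rule sum_cong.add)
  ultimately show ?thesis by (simp add: add.commute[of y] sum_cong.trans[of R "x + x'"])
qed

lemma sum_cong_sum:
  assumes "\<And>e. e \<in> E \<Longrightarrow> sum_cong R (f e) (g e)"
  shows "sum_cong R (\<Sum>e\<in>E. f e) (\<Sum>e\<in>E. g e)"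
  using assms
proof (induction E rule: infinite_finite_induct)
  case (insert e E)
  then have "sum_cong R (f e + (\<Sum>e\<in>E. f e)) (g e + (\<Sum>e\<in>E. g e))"
    by (intro sum_cong_union[of R "f e" "g e"]) simp_all
  then show ?case using insert(1,2) by simp
qed (simp_all add: sum_cong.refl)

text \<open>If every pure tensor \<open>v \<otimes> p\<close> occurring in \<open>x\<close> expands as \<open>\<Sum>\<^sub>e \<kappa>\<^sub>e(p) v \<otimes> e\<close> over a fixed finite set
  \<open>E\<close>, then collecting terms shows that the class of \<open>x\<close> depends only on its coordinates
  \<open>\<Sum> \<kappa>\<^sub>e(p) v\<close>. Used with \<open>E\<close> a set of basis elements of \<open>H\<close>, and of pairs of them.\<close>

lemma sum_cong_normal_form:
  fixes E :: "'p set"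
  assumes V: "vsub s V" and E: "finite E"
    and add: "\<And>v w e. v \<in> V \<Longrightarrow> w \<in> V \<Longrightarrow> e \<in> E \<Longrightarrow> sum_cong R {#(v + w, e)#} {#(v, e), (w, e)#}"
    and zero: "\<And>e. e \<in> E \<Longrightarrow> sum_cong R {#(0, e)#} {#}"
    and expand: "\<And>v p. (v, p) \<in># x \<Longrightarrow> sum_cong R {#(v, p)#} (\<Sum>e\<in>E. {#(s (\<kappa> e p) v, e)#})"
    and x: "set_mset x \<subseteq> V \<times> UNIV"
  shows "sum_cong R x (\<Sum>e\<in>E. {#(tsum x (\<lambda>v p. s (\<kappa> e p) v), e)#})"
  using x expand
proof (induction x)
  case empty
  have "sum_cong R (\<Sum>e\<in>E. {#(0, e)#}) (\<Sum>e\<in>E. {#})"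
    by (rule sum_cong_sum) (rule zero)
  then show ?case by (simp add: sum_cong.sym)
next
  case (add z x)
  obtain v p where z: "z = (v, p)" by (cases z)
  have v: "v \<in> V" using add.prems z by auto
  have in_V: "tsum x (\<lambda>v p. s (\<kappa> e p) v) \<in> V" for e
    by (rule tsum_in[OF V]) (use add.prems vsubD(3)[OF V] in auto)
  have "sum_cong R ({#(v, p)#} + x)
     ((\<Sum>e\<in>E. {#(s (\<kappa> e p) v, e)#}) + (\<Sum>e\<in>E. {#(tsum x (\<lambda>v p. s (\<kappa> e p) v), e)#}))"
    by (rule sum_cong_union) (use add z in auto)
  also have "(\<Sum>e\<in>E. {#(s (\<kappa> e p) v, e)#}) + (\<Sum>e\<in>E. {#(tsum x (\<lambda>v p. s (\<kappa> e p) v), e)#})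
      = (\<Sum>e\<in>E. {#(s (\<kappa> e p) v, e), (tsum x (\<lambda>v p. s (\<kappa> e p) v), e)#})"
    by (simp add: sum.distrib[symmetric] add_mset_commute)
  finally have 1: "sum_cong R (add_mset z x) \<dots>" by (simp add: z)
  have 2: "sum_cong R (\<Sum>e\<in>E. {#(s (\<kappa> e p) v, e), (tsum x (\<lambda>v p. s (\<kappa> e p) v), e)#})
     (\<Sum>e\<in>E. {#(s (\<kappa> e p) v + tsum x (\<lambda>v p. s (\<kappa> e p) v), e)#})"
    by (rule sum_cong_sum, rule sum_cong.sym, rule assms(3)) (use v in_V vsubD(3)[OF V] in auto)
  show ?case using sum_cong.trans[OF 1 2] by (simp add: z)
qed

text \<open>A finite part of a basis of \<open>H\<close> that suffices to expand finitely many elements,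
  together with the coordinate functionals.\<close>

lemma finite_coordinates:
  fixes sH :: "'k::field \<Rightarrow> 'h::ab_group_add \<Rightarrow> 'h"
  assumes "vector_space sH" "finite X"
  obtains E r where "finite E" "\<And>b. linear_on sH UNIV (*) UNIV (r b)"
    "\<And>h. h \<in> X \<Longrightarrow> h = (\<Sum>b\<in>E. sH (r b h) b)"
proof -
  interpret vector_space sH by fact
  define B where "B = extend_basis {}"
  have B: "independent B" "span B = UNIV"
    using independent_extend_basis[of "{}"] span_extend_basis[of "{}"] by (auto simp: B_def independent_empty)
  define r where "r b h = representation B h b" for b h
  define E where "E = (\<Union>h\<in>X. {b. r b h \<noteq> 0})"
  show thesis
  proof (rule that[of E r])
    show "finite E" using assms(2) finite_representation by (auto simp: E_def r_def)
    show "linear_on sH UNIV (*) UNIV (r b)" for b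
      using B by (auto simp: linear_on_def r_def representation_add representation_scale)
    show "h = (\<Sum>b\<in>E. sH (r b h) b)" if "h \<in> X" for h
    proof -
      have "(\<Sum>b\<in>E. sH (representation B h b) b) = (\<Sum>b | representation B h b \<noteq> 0. sH (representation B h b) b)"
        by (rule sum.mono_neutral_right) (use \<open>finite E\<close> that in \<open>auto simp: E_def r_def\<close>)
      then show ?thesis using sum_nonzero_representation_eq[of B h] B by (simp add: r_def)
    qed
  qed
qed

lemma tensor_expand:
  assumes V: "vsub s V" and sH: "vsub sH UNIV" and v: "v \<in> V" and E: "finite E"
  shows "tensor_eq s sH V {#(v, \<Sum>b\<in>E. sH (c b) b)#} (\<Sum>b\<in>E. {#(s (c b) v, b)#})"
  using E unfolding tensor_eq_def
proof (induction E)
  case empty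
  have "sum_cong (bilinear_rel s sH V) {#(s 0 v, 0)#} {#(v, sH 0 0)#}"
    by (intro sum_cong.base bilinear_rel.intros v)
  then have "sum_cong (bilinear_rel s sH V) {#(v, 0)#} {#(0, 0)#}"
    by (simp add: vsubD(8)[OF V] vsubD(8)[OF sH] sum_cong.sym)
  moreover have "sum_cong (bilinear_rel s sH V) {#(0, 0)#} {#}"
    by (intro sum_cong.base bilinear_rel.intros)
  ultimately show ?case using sum_cong.trans by simp
next
  case (insert b E)
  have 1: "sum_cong (bilinear_rel s sH V) {#(v, sH (c b) b + (\<Sum>b\<in>E. sH (c b) b))#}
     ({#(v, sH (c b) b)#} + {#(v, \<Sum>b\<in>E. sH (c b) b)#})"
    using sum_cong.base[of "bilinear_rel s sH V", OF bilinear_rel.intros(2)[OF v]]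
    by (simp add: add_mset_commute)
  have 2: "sum_cong (bilinear_rel s sH V) ({#(v, sH (c b) b)#} + {#(v, \<Sum>b\<in>E. sH (c b) b)#})
     ({#(s (c b) v, b)#} + (\<Sum>b\<in>E. {#(s (c b) v, b)#}))"
    by (rule sum_cong_union[OF sum_cong.sym[OF sum_cong.base] insert.IH])
      (rule bilinear_rel.intros(3)[OF v])
  show ?case using sum_cong.trans[OF 1 2] insert(1,2) by simp
qed

lemma tensor_normal_form:
  fixes sH :: "'k::field \<Rightarrow> 'h::ab_group_add \<Rightarrow> 'h"
  assumes V: "vsub s V" and sH: "vsub sH UNIV" and E: "finite E"
    and r: "\<And>v h. (v, h) \<in># x \<Longrightarrow> h = (\<Sum>b\<in>E. sH (r b h) b)"
    and x: "set_mset x \<subseteq> V \<times> UNIV"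
  shows "tensor_eq s sH V x (\<Sum>b\<in>E. {#(tsum x (\<lambda>v h. s (r b h) v), b)#})"
  unfolding tensor_eq_def
proof (rule sum_cong_normal_form[OF V E _ _ _ x])
  show "sum_cong (bilinear_rel s sH V) {#(v + w, e)#} {#(v, e), (w, e)#}" if "v \<in> V" "w \<in> V" for v w e
    using that by (intro sum_cong.base bilinear_rel.intros)
  show "sum_cong (bilinear_rel s sH V) {#(0, e)#} {#}" for e
    by (intro sum_cong.base bilinear_rel.intros)
  show "sum_cong (bilinear_rel s sH V) {#(v, h)#} (\<Sum>b\<in>E. {#(s (r b h) v, b)#})"
    if "(v, h) \<in># x" for v h
    using tensor_expand[OF V sH _ E, of v "\<lambda>b. r b h"] r[OF that] x that
    unfolding tensor_eq_def by auto
qed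

text \<open>Converse of \<open>tensor_eq_tsum\<close>. The hypothesis does not depend on the subspace \<open>V\<close>, so the
  lemma contains the injectivity of \<open>K \<otimes> H \<rightarrow> V \<otimes> H\<close> for subspaces \<open>K\<close> of \<open>V\<close>.\<close>

lemma tensor_eqI:
  fixes sH :: "'k::field \<Rightarrow> 'h::ab_group_add \<Rightarrow> 'h"
  assumes V: "vsub s V" and sH: "vsub sH UNIV"
    and x: "set_mset x \<subseteq> V \<times> UNIV" and y: "set_mset y \<subseteq> V \<times> UNIV"
    and eq: "\<And>\<chi>. linear_on sH UNIV (*) UNIV \<chi> \<Longrightarrow>
      tsum x (\<lambda>v h. s (\<chi> h) v) = tsum y (\<lambda>v h. s (\<chi> h) v)"
  shows "tensor_eq s sH V x y"
proof -
  have "vector_space sH" using sH by (simp add: vsub_def)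
  moreover have "finite (snd ` set_mset (x + y))" by simp
  ultimately obtain E r where E: "finite E" and r: "\<And>b. linear_on sH UNIV (*) UNIV (r b)"
    "\<And>h. h \<in> snd ` set_mset (x + y) \<Longrightarrow> h = (\<Sum>b\<in>E. sH (r b h) b)"
    by (rule finite_coordinates) blast
  have *: "h = (\<Sum>b\<in>E. sH (r b h) b)" if "(v, h) \<in># x \<or> (v, h) \<in># y" for v h
    by (rule r(2)) (use that in force)
  have "tensor_eq s sH V x (\<Sum>b\<in>E. {#(tsum x (\<lambda>v h. s (r b h) v), b)#})"
    by (rule tensor_normal_form[OF V sH E _ x]) (use * in blast)
  moreover have "tensor_eq s sH V y (\<Sum>b\<in>E. {#(tsum y (\<lambda>v h. s (r b h) v), b)#})"
    by (rule tensor_normal_form[OF V sH E _ y]) (use * in blast)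
  ultimately show ?thesis
    unfolding eq[OF r(1)] tensor_eq_def by (rule sum_cong.trans[OF _ sum_cong.sym])
qed

lemma tensor3_expand:
  fixes sH :: "'k::field \<Rightarrow> 'h::ab_group_add \<Rightarrow> 'h"
  assumes V: "vsub s V" and sH: "vsub sH UNIV" and v: "v \<in> V" and E: "finite E"
  shows "tensor3_eq s sH V {#(v, \<Sum>b\<in>E. sH (c b) b, \<Sum>b\<in>E. sH (d b) b)#}
    (\<Sum>(b, b')\<in>E \<times> E. {#(s (c b * d b') v, b, b')#})"
proof -
  let ?R = "trilinear_rel s sH V"
  note intr = trilinear_rel.intros[where s=s and sH=sH and V=V, THEN sum_cong.base[of ?R]]
  \<comment> \<open>Only \<open>0 \<otimes> h \<otimes> g = 0\<close> is a relation; a zero in another factor is moved there as a scalar.\<close>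
  have zero: "sum_cong ?R {#(w, 0, g)#} {#}" "sum_cong ?R {#(w, g, 0)#} {#}" if "w \<in> V" for w g
  proof -
    have "sum_cong ?R {#(s 0 w, 0, g)#} {#(w, sH 0 0, g)#}"
      "sum_cong ?R {#(w, sH 0 g, 0)#} {#(w, g, sH 0 0)#}"
      using intr(4,5) that by auto
    then have 1: "sum_cong ?R {#(0, 0, g)#} {#(w, 0, g)#}" "sum_cong ?R {#(w, 0, 0)#} {#(w, g, 0)#}"
      by (simp_all add: vsubD(8)[OF V] vsubD(8)[OF sH])
    have 2: "sum_cong ?R {#(0, 0, g)#} {#}" for g using intr(6) by auto
    show 3: "sum_cong ?R {#(w, 0, g)#} {#}" by (rule sum_cong.trans[OF sum_cong.sym[OF 1(1)] 2])
    have "sum_cong ?R {#(s 0 w, 0, 0)#} {#(w, sH 0 0, 0)#}" using intr(4) that by auto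
    then have "sum_cong ?R {#(0, 0, 0)#} {#(w, 0, 0)#}"
      by (simp add: vsubD(8)[OF V] vsubD(8)[OF sH])
    then show "sum_cong ?R {#(w, g, 0)#} {#}" by (rule sum_cong.trans[OF sum_cong.trans[OF sum_cong.sym[OF 1(2)] sum_cong.sym] 2])
  qed
  have left: "sum_cong ?R {#(w, \<Sum>b\<in>F. sH (c b) b, g)#} (\<Sum>b\<in>F. {#(s (c b) w, b, g)#})"
    if w: "w \<in> V" and F: "finite F" for w F g
    using F
  proof (induction F)
    case empty show ?case using zero(1)[OF w] by simp
  next
    case (insert b F)
    have 1: "sum_cong ?R {#(w, sH (c b) b + (\<Sum>b\<in>F. sH (c b) b), g)#}
       ({#(w, sH (c b) b, g)#} + {#(w, \<Sum>b\<in>F. sH (c b) b, g)#})"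
      using intr(2)[OF w, of "sH (c b) b" "\<Sum>b\<in>F. sH (c b) b" g]
      by (simp add: add_mset_commute)
    have 2: "sum_cong ?R ({#(w, sH (c b) b, g)#} + {#(w, \<Sum>b\<in>F. sH (c b) b, g)#})
       ({#(s (c b) w, b, g)#} + (\<Sum>b\<in>F. {#(s (c b) w, b, g)#}))"
      by (rule sum_cong_union[OF sum_cong.sym[OF intr(4)[OF w]] insert.IH])
    show ?case using sum_cong.trans[OF 1 2] insert(1,2) by simp
  qed
  have right: "sum_cong ?R {#(w, g, \<Sum>b\<in>F. sH (d b) b)#} (\<Sum>b\<in>F. {#(s (d b) w, g, b)#})"
    if w: "w \<in> V" and F: "finite F" for w F g
    using F
  proof (induction F)
    case empty show ?case using zero(2)[OF w] by simp
  next
    case (insert b F)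
    have 1: "sum_cong ?R {#(w, g, sH (d b) b + (\<Sum>b\<in>F. sH (d b) b))#}
       ({#(w, g, sH (d b) b)#} + {#(w, g, \<Sum>b\<in>F. sH (d b) b)#})"
      using intr(3)[OF w, of g "sH (d b) b" "\<Sum>b\<in>F. sH (d b) b"]
      by (simp add: add_mset_commute)
    have "sum_cong ?R {#(w, g, sH (d b) b)#} {#(s (d b) w, g, b)#}"
      by (rule sum_cong.sym, rule sum_cong.trans[OF intr(4) intr(5)]) (use w in auto)
    then have 2: "sum_cong ?R ({#(w, g, sH (d b) b)#} + {#(w, g, \<Sum>b\<in>F. sH (d b) b)#})
       ({#(s (d b) w, g, b)#} + (\<Sum>b\<in>F. {#(s (d b) w, g, b)#}))"
      by (rule sum_cong_union[OF _ insert.IH])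
    show ?case using sum_cong.trans[OF 1 2] insert(1,2) by simp
  qed
  have "sum_cong ?R (\<Sum>b\<in>E. {#(s (c b) v, b, \<Sum>b\<in>E. sH (d b) b)#})
    (\<Sum>b\<in>E. \<Sum>b'\<in>E. {#(s (d b') (s (c b) v), b, b')#})"
    by (rule sum_cong_sum, rule right) (use vsubD(3)[OF V] v E in auto)
  from sum_cong.trans[OF left[OF v E] this] show ?thesis
    unfolding tensor3_eq_def
    by (simp add: sum.cartesian_product vsubD(6)[OF V] mult.commute)
qed

lemma tensor3_eqI:
  fixes sH :: "'k::field \<Rightarrow> 'h::ab_group_add \<Rightarrow> 'h"
  assumes V: "vsub s V" and sH: "vsub sH UNIV"
    and x: "set_mset x \<subseteq> V \<times> UNIV" and y: "set_mset y \<subseteq> V \<times> UNIV"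
    and eq: "\<And>\<chi> \<psi>. linear_on sH UNIV (*) UNIV \<chi> \<Longrightarrow> linear_on sH UNIV (*) UNIV \<psi> \<Longrightarrow>
      (\<Sum>(v, h, g)\<in>#x. s (\<chi> h * \<psi> g) v) = (\<Sum>(v, h, g)\<in>#y. s (\<chi> h * \<psi> g) v)"
  shows "tensor3_eq s sH V x y"
proof -
  define X where "X = fst ` snd ` set_mset (x + y) \<union> snd ` snd ` set_mset (x + y)"
  have "vector_space sH" using sH by (simp add: vsub_def)
  moreover have "finite X" by (simp add: X_def)
  ultimately obtain E r where E: "finite E" and r: "\<And>b. linear_on sH UNIV (*) UNIV (r b)"
    "\<And>h. h \<in> X \<Longrightarrow> h = (\<Sum>b\<in>E. sH (r b h) b)"
    by (rule finite_coordinates) blast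
  define \<kappa> where "\<kappa> = (\<lambda>(b, b') (h, g). r b h * r b' g)"
  \<comment> \<open>\<open>\<kappa>\<close> gives the coordinates in \<open>H \<otimes> H\<close> with respect to the basis elements \<open>b \<otimes> b'\<close>.\<close>
  have normal: "tensor3_eq s sH V z (\<Sum>e\<in>E \<times> E. {#(tsum z (\<lambda>v p. s (\<kappa> e p) v), e)#})"
    if z: "z = x \<or> z = y" for z
    unfolding tensor3_eq_def
  proof (rule sum_cong_normal_form[OF V])
    show "sum_cong (trilinear_rel s sH V) {#(v + w, e)#} {#(v, e), (w, e)#}"
      if "v \<in> V" "w \<in> V" for v w e
      using that by (cases e) (auto intro!: sum_cong.base trilinear_rel.intros)
    show "sum_cong (trilinear_rel s sH V) {#(0, e)#} {#}" for e
      by (cases e) (auto intro!: sum_cong.base trilinear_rel.intros)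
    show "set_mset z \<subseteq> V \<times> UNIV" using x y z by auto
    fix v p assume vp: "(v, p) \<in># z"
    obtain h g where p: "p = (h, g)" by (cases p)
    have "(v, h, g) \<in># x + y" using vp z p by auto
    then have "h \<in> X" "g \<in> X" unfolding X_def
      by (metis UnI1 UnI2 fst_conv snd_conv image_eqI)+
    moreover have "v \<in> V" using vp z x y by auto
    ultimately show "sum_cong (trilinear_rel s sH V) {#(v, p)#} (\<Sum>e\<in>E \<times> E. {#(s (\<kappa> e p) v, e)#})"
      using tensor3_expand[OF V sH \<open>v \<in> V\<close> E, of "\<lambda>b. r b h" "\<lambda>b. r b g"] r(2)
      by (simp add: tensor3_eq_def \<kappa>_def p split_def)
  qed (use E in auto)
  have *: "tsum x (\<lambda>v p. s (\<kappa> e p) v) = tsum y (\<lambda>v p. s (\<kappa> e p) v)" for e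
    using eq[OF r(1) r(1), of "fst e" "snd e"] by (simp add: tsum_def \<kappa>_def split_def)
  have "tensor3_eq s sH V x (\<Sum>e\<in>E \<times> E. {#(tsum y (\<lambda>v p. s (\<kappa> e p) v), e)#})"
    using normal[of x] unfolding * by simp
  moreover have "tensor3_eq s sH V y (\<Sum>e\<in>E \<times> E. {#(tsum y (\<lambda>v p. s (\<kappa> e p) v), e)#})"
    using normal[of y] by simp
  ultimately show ?thesis
    unfolding tensor3_eq_def by (rule sum_cong.trans[OF _ sum_cong.sym])
qed


section \<open>Sweedler calculus\<close>

text \<open>Introduction rules proving that an expression is linear in one of its variables; they
  discharge the multilinearity conditions of the Sweedler identities below.\<close>

named_theorems lin

lemma linear_on_ident [lin]: "linear_on s V s V (\<lambda>x. x)"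
  by (simp add: linear_on_def)

lemmas [lin] = tsum_linear

lemma linear_on_scale [lin]:
  assumes "vsub t W" "linear_on s V t W f"
  shows "linear_on s V t W (\<lambda>v. t c (f v))"
  by (rule linear_onI) (simp_all add: vsubD[OF assms(1)] linear_onD[OF assms(2)] mult.commute)

lemma linear_on_functional [lin]:
  assumes "vsub t W" "linear_on s V (*) UNIV f" "w \<in> W"
  shows "linear_on s V t W (\<lambda>v. t (f v) w)"
  by (rule linear_onI) (simp_all add: vsubD[OF assms(1)] linear_onD[OF assms(2)] assms(3))

lemma bilin_linear:
  assumes "bilin s V sH t W F"
  shows "linear_on s' V' s V f \<Longrightarrow> linear_on s' V' t W (\<lambda>x. F (f x) h)"
    and "linear_on s' V' sH UNIV g \<Longrightarrow> v \<in> V \<Longrightarrow> linear_on s' V' t W (\<lambda>x. F v (g x))"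
  using linear_on_comp bilinD(1,2)[OF assms] by blast+

lemma tsum_scale:
  assumes "vsub t W" "\<And>v h. (v, h) \<in># x \<Longrightarrow> F v h \<in> W"
  shows "tsum x (\<lambda>v h. t c (F v h)) = t c (tsum x F)"
  by (rule linear_on_tsum[symmetric, OF linear_on_scale[OF assms(1) linear_on_ident] assms])

lemma tsum_mult_left: "c * tsum x F = tsum x (\<lambda>v h. c * (F v h :: 'a::semiring_0))"
  unfolding tsum_def split_def by (simp add: sum_mset_distrib_left)

lemma tsum_mult_right: "tsum x F * c = tsum x (\<lambda>v h. (F v h :: 'a::semiring_0) * c)"
  unfolding tsum_def split_def by (simp add: sum_mset_distrib_right)

locale hopf_alg =
  fixes H :: "('k::field_char_0, 'h::ring_1) hopf"
  assumes hopf: "hopf_algebra H"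
begin

abbreviation "sH \<equiv> hscale H"
abbreviation "\<Delta> \<equiv> comult H"
abbreviation "\<epsilon> \<equiv> counit H"
abbreviation "S \<equiv> antipode H"

lemma vsub_H [lin, simp]: "vsub sH UNIV"
  using hopf vsub_UNIV by (auto simp: hopf_algebra_def algebra_over_def)

lemma scale_mult: "sH c x * y = sH c (x * y)" "x * sH c y = sH c (x * y)"
  using hopf by (auto simp: hopf_algebra_def algebra_over_def)

lemma mult_linear [lin]:
  assumes "linear_on s V sH UNIV f"
  shows "linear_on s V sH UNIV (\<lambda>x. f x * c)" and "linear_on s V sH UNIV (\<lambda>x. c * f x)"
  by (rule linear_onI; simp add: linear_onD[OF assms] scale_mult algebra_simps)+

lemma counit_linear [lin]:
  "linear_on s V sH UNIV f \<Longrightarrow> linear_on s V (*) UNIV (\<lambda>x. \<epsilon> (f x))"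
  by (rule linear_on_comp[OF linear_on_UNIV]) (use hopf in \<open>auto simp: hopf_algebra_def\<close>)

lemma antipode_linear [lin]:
  "linear_on s V sH UNIV f \<Longrightarrow> linear_on s V sH UNIV (\<lambda>x. S (f x))"
  by (rule linear_on_comp[OF linear_on_UNIV]) (use hopf in \<open>auto simp: hopf_algebra_def\<close>)

lemma counit_one: "\<epsilon> 1 = 1" and counit_mult: "\<epsilon> (x * y) = \<epsilon> x * \<epsilon> y"
  using hopf by (auto simp: hopf_algebra_def)

lemma comodule_self: "right_comodule H sH UNIV \<Delta>"
  using hopf by (auto simp: hopf_algebra_def)

lemma counit_left: "tsum (\<Delta> h) (\<lambda>x y. sH (\<epsilon> x) y) = h"
  and antipode_left: "tsum (\<Delta> h) (\<lambda>x y. S x * y) = sH (\<epsilon> h) 1"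
  and antipode_right: "tsum (\<Delta> h) (\<lambda>x y. x * S y) = sH (\<epsilon> h) 1"
  using hopf by (simp_all add: hopf_algebra_def tsum_def)

lemma comodule_vsub: "right_comodule H s V \<rho> \<Longrightarrow> vsub s V"
  by (simp add: right_comodule_def vsub_def)

lemma comodule_mem:
  "right_comodule H s V \<rho> \<Longrightarrow> (x, h) \<in># \<rho> v \<Longrightarrow> v \<in> V \<Longrightarrow> x \<in> V"
  unfolding right_comodule_def by blast

text \<open>The coaction is linear in the variable it is applied to: \<open>v \<mapsto> F v\<^sub>0 v\<^sub>1\<close> is linear.\<close>

lemma comodule_linear:
  assumes \<rho>: "right_comodule H s V \<rho>" and F: "bilin s V sH t W F" and W: "vsub t W"
    and f: "linear_on s' V' s V f"
  shows "linear_on s' V' t W (\<lambda>v. tsum (\<rho> (f v)) F)"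
proof (rule linear_on_comp[OF _ f], rule linear_onI)
  note V = comodule_vsub[OF \<rho>]
  note mem = comodule_mem[OF \<rho>]
  show "tsum (\<rho> v) F \<in> W" if "v \<in> V" for v
    by (rule tsum_in[OF W]) (rule bilinD(3)[OF F mem[OF _ that]])
  show "tsum (\<rho> (v + w)) F = tsum (\<rho> v) F + tsum (\<rho> w) F" if "v \<in> V" "w \<in> V" for v w
  proof -
    have "tensor_eq s sH V (\<rho> (v + w)) (\<rho> v + \<rho> w)"
      using \<rho> that by (simp add: right_comodule_def)
    from tensor_eq_tsum[OF this F V] show ?thesis by simp
  qed
  show "tsum (\<rho> (s c v)) F = t c (tsum (\<rho> v) F)" if v: "v \<in> V" for c v
  proof -
    have "tensor_eq s sH V (\<rho> (s c v)) {#(s c x, h). (x, h) \<in># \<rho> v#}"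
      using \<rho> v by (simp add: right_comodule_def)
    from tensor_eq_tsum[OF this F V]
    have "tsum (\<rho> (s c v)) F = tsum (\<rho> v) (\<lambda>x h. F (s c x) h)" by simp
    also have "\<dots> = tsum (\<rho> v) (\<lambda>x h. t c (F x h))"
      by (rule tsum_cong[OF HOL.refl]) (rule linear_onD(3)[OF bilinD(1)[OF F] mem[OF _ v]])
    also have "\<dots> = t c (tsum (\<rho> v) F)"
      by (rule tsum_scale[OF W]) (rule bilinD(3)[OF F mem[OF _ v]])
    finally show ?thesis .
  qed
qed

lemmas comult_linear [lin] = comodule_linear[OF comodule_self]

lemma comodule_counit:
  assumes \<rho>: "right_comodule H s V \<rho>" and L: "linear_on s V t W L" and v: "v \<in> V"
  shows "tsum (\<rho> v) (\<lambda>x h. t (\<epsilon> h) (L x)) = L v"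
proof -
  note V = comodule_vsub[OF \<rho>]
  have "tsum (\<rho> v) (\<lambda>x h. t (\<epsilon> h) (L x)) = tsum (\<rho> v) (\<lambda>x h. L (s (\<epsilon> h) x))"
    by (rule tsum_cong[OF HOL.refl]) (rule linear_onD(3)[OF L comodule_mem[OF \<rho> _ v], symmetric])
  also have "\<dots> = L (tsum (\<rho> v) (\<lambda>x h. s (\<epsilon> h) x))"
    by (rule linear_on_tsum[symmetric, OF L V]) (rule vsubD(3)[OF V comodule_mem[OF \<rho> _ v]])
  also have "tsum (\<rho> v) (\<lambda>x h. s (\<epsilon> h) x) = v"
    using \<rho> v by (simp add: right_comodule_def tsum_def)
  finally show ?thesis .
qed

text \<open>\<open>F m\<^sub>0\<^sub>0 m\<^sub>0\<^sub>1 m\<^sub>1 = F m\<^sub>0 m\<^sub>1\<^sub>1 m\<^sub>1\<^sub>2\<close>; iterated coproducts are rebracketed with this rule only.\<close>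

lemma comodule_coassoc:
  assumes \<rho>: "right_comodule H s V \<rho>" and F: "trilin s V sH t W F" and v: "v \<in> V"
  shows "tsum (\<rho> v) (\<lambda>x h. tsum (\<rho> x) (\<lambda>y g. F y g h)) =
    tsum (\<rho> v) (\<lambda>x h. tsum (\<Delta> h) (\<lambda>h1 h2. F x h1 h2))"
proof -
  have nested: "(\<Sum>(v, h, g)\<in>#(\<Sum>(x, h)\<in>#z. f x h). F v h g)
      = tsum z (\<lambda>x h. \<Sum>(v, h, g)\<in>#f x h. F v h g)" for z and f :: "_ \<Rightarrow> _ \<Rightarrow> _ multiset"
    by (induction z) auto
  have inner: "(\<Sum>(v, h, g)\<in>#{#(y, g, h). (y, g) \<in># z#}. F v h g) = tsum z (\<lambda>y g. F y g h)"
    "(\<Sum>(v, h, g)\<in>#{#(x, h1, h2). (h1, h2) \<in># z'#}. F v h g) = tsum z' (F x)" for z z' h x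
    by (induction z, auto) (induction z', auto)
  have "tensor3_eq s sH V
        (\<Sum>(x, h)\<in>#\<rho> v. {#(y, g, h). (y, g) \<in># \<rho> x#})
        (\<Sum>(x, h)\<in>#\<rho> v. {#(x, h1, h2). (h1, h2) \<in># \<Delta> h#})"
    using \<rho> v by (simp add: right_comodule_def)
  from tensor3_eq_eval[OF this F comodule_vsub[OF \<rho>]] show ?thesis
    unfolding nested inner .
qed

lemmas comult_coassoc = comodule_coassoc[OF comodule_self _ UNIV_I]
lemmas counit_right = comodule_counit[OF comodule_self _ UNIV_I]

lemma counit_left_linear:
  assumes L: "linear_on sH UNIV t W L"
  shows "tsum (\<Delta> h) (\<lambda>x y. t (\<epsilon> x) (L y)) = L h"
proof -
  have "tsum (\<Delta> h) (\<lambda>x y. t (\<epsilon> x) (L y)) = L (tsum (\<Delta> h) (\<lambda>x y. sH (\<epsilon> x) y))"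
    by (subst linear_on_tsum[OF L vsub_H]) (auto simp: linear_onD(3)[OF L])
  then show ?thesis by (simp add: counit_left)
qed

lemma comult_one: "bilin sH UNIV sH t W F \<Longrightarrow> tsum (\<Delta> 1) F = F 1 1"
proof -
  have "tensor_eq sH sH UNIV (\<Delta> 1) {#(1, 1)#}" using hopf by (simp add: hopf_algebra_def)
  then show "tsum (\<Delta> 1) F = F 1 1" if "bilin sH UNIV sH t W F"
    using tensor_eq_tsum[OF _ that vsub_H] by fastforce
qed

lemma comult_mult:
  assumes "bilin sH UNIV sH t W F"
  shows "tsum (\<Delta> (x * y)) F = tsum (\<Delta> x) (\<lambda>a a'. tsum (\<Delta> y) (\<lambda>b b'. F (a * b) (a' * b')))"
proof -
  have "tensor_eq sH sH UNIV (\<Delta> (x * y)) (tensor_op (*) (\<Delta> x) (\<Delta> y))"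
    using hopf by (simp add: hopf_algebra_def)
  from tensor_eq_tsum[OF this assms vsub_H] show ?thesis by (simp add: tsum_tensor_op)
qed


section \<open>The antipode is an antimorphism\<close>

lemma antipode_one: "S 1 = 1"
proof -
  have "bilin sH UNIV sH sH UNIV (\<lambda>x y. S x * y)" by (auto intro!: bilinI lin)
  from comult_one[OF this] show ?thesis
    by (simp add: antipode_left counit_one vsubD(7)[OF vsub_H])
qed

lemma antipode_scale: "S (sH c x) = sH c (S x)"
  using antipode_linear[OF linear_on_ident] by (simp add: linear_on_def)

text \<open>Both sides equal \<open>S(x\<^sub>1y\<^sub>1) x\<^sub>2y\<^sub>2 S(y\<^sub>3)S(x\<^sub>3)\<close>: \<open>S\<close> composed with multiplication and
  \<open>x \<otimes> y \<mapsto> S(y)S(x)\<close> are a left and a right convolution inverse of multiplication.\<close>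

lemma antipode_mult: "S (x * y) = S y * S x"
proof -
  let ?P = "\<lambda>x1 a a' y1 b b'. S (x1 * y1) * (a * b * S b' * S a')"
  define Q where "Q = tsum (\<Delta> x) (\<lambda>x1 x2. tsum (\<Delta> x2) (\<lambda>a a'.
    tsum (\<Delta> y) (\<lambda>y1 y2. tsum (\<Delta> y2) (\<lambda>b b'. ?P x1 a a' y1 b b'))))"
  have yR: "tsum (\<Delta> y) (\<lambda>y1 y2. tsum (\<Delta> y2) (\<lambda>b b'. ?P x1 a a' y1 b b'))
      = S (x1 * y) * (a * S a')" for x1 a a'
  proof -
    have "tsum (\<Delta> y2) (\<lambda>b b'. ?P x1 a a' y1 b b') = sH (\<epsilon> y2) (S (x1 * y1) * (a * S a'))" for y1 y2
    proof -
      have "tsum (\<Delta> y2) (\<lambda>b b'. ?P x1 a a' y1 b b')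
          = S (x1 * y1) * (a * tsum (\<Delta> y2) (\<lambda>b b'. b * S b') * S a')"
        unfolding tsum_mult_left tsum_mult_right by (simp add: mult.assoc)
      then show ?thesis by (simp add: antipode_right scale_mult)
    qed
    moreover have "linear_on sH UNIV sH UNIV (\<lambda>y1. S (x1 * y1) * (a * S a'))"
      by (auto intro!: lin)
    note counit_right[OF this, of y]
    ultimately show ?thesis by simp
  qed
  have "tsum (\<Delta> x2) (\<lambda>a a'. S (x1 * y) * (a * S a')) = sH (\<epsilon> x2) (S (x1 * y))" for x1 x2
    by (simp add: tsum_mult_left[symmetric] antipode_right scale_mult)
  moreover have "linear_on sH UNIV sH UNIV (\<lambda>x1. S (x1 * y))"
    by (auto intro!: lin)
  note counit_right[OF this, of x]
  ultimately have 1: "Q = S (x * y)"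
    unfolding Q_def yR by simp
  have "tsum (\<Delta> y) (\<lambda>y1 y2. tsum (\<Delta> y2) (\<lambda>b b'. ?P x1 a a' y1 b b'))
     = tsum (\<Delta> y) (\<lambda>y' b'. tsum (\<Delta> y') (\<lambda>y1 b. ?P x1 a a' y1 b b'))" for x1 a a'
    by (rule comult_coassoc[symmetric]) (auto intro!: trilinI lin)
  then have "Q = tsum (\<Delta> x) (\<lambda>x1 x2. tsum (\<Delta> x2) (\<lambda>a a'.
      tsum (\<Delta> y) (\<lambda>y' b'. tsum (\<Delta> y') (\<lambda>y1 b. ?P x1 a a' y1 b b'))))"
    by (simp add: Q_def)
  also have "\<dots> = tsum (\<Delta> x) (\<lambda>x' a'. tsum (\<Delta> x') (\<lambda>x1 a.
      tsum (\<Delta> y) (\<lambda>y' b'. tsum (\<Delta> y') (\<lambda>y1 b. ?P x1 a a' y1 b b'))))"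
    by (rule comult_coassoc[symmetric]) (auto intro!: trilinI lin bilinI)
  also have "\<dots> = tsum (\<Delta> x) (\<lambda>x' a'. tsum (\<Delta> y) (\<lambda>y' b'. sH (\<epsilon> x' * \<epsilon> y') (S b' * S a')))"
  proof (intro tsum_cong[OF HOL.refl])
    fix x' a'
    have "tsum (\<Delta> x') (\<lambda>x1 a. tsum (\<Delta> y') (\<lambda>y1 b. ?P x1 a a' y1 b b'))
        = sH (\<epsilon> x' * \<epsilon> y') (S b' * S a')" for y' b'
    proof -
      have "tsum (\<Delta> x') (\<lambda>x1 a. tsum (\<Delta> y') (\<lambda>y1 b. ?P x1 a a' y1 b b'))
          = tsum (\<Delta> x') (\<lambda>x1 a. tsum (\<Delta> y') (\<lambda>y1 b. S (x1 * y1) * (a * b))) * (S b' * S a')"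
        unfolding tsum_mult_right by (simp add: mult.assoc)
      also have "tsum (\<Delta> x') (\<lambda>x1 a. tsum (\<Delta> y') (\<lambda>y1 b. S (x1 * y1) * (a * b)))
          = tsum (\<Delta> (x' * y')) (\<lambda>p q. S p * q)"
        by (rule comult_mult[symmetric]) (auto intro!: bilinI lin)
      finally show ?thesis by (simp add: antipode_left scale_mult counit_mult)
    qed
    then show "tsum (\<Delta> x') (\<lambda>x1 a. tsum (\<Delta> y) (\<lambda>y' b'. tsum (\<Delta> y') (\<lambda>y1 b. ?P x1 a a' y1 b b')))
        = tsum (\<Delta> y) (\<lambda>y' b'. sH (\<epsilon> x' * \<epsilon> y') (S b' * S a'))"
      by (subst tsum_swap) simp
  qed
  also have "\<dots> = tsum (\<Delta> x) (\<lambda>x' a'. sH (\<epsilon> x') (S y * S a'))"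
  proof (intro tsum_cong[OF HOL.refl])
    fix x' a'
    have "linear_on sH UNIV sH UNIV (\<lambda>b. sH (\<epsilon> x') (S b * S a'))" by (auto intro!: lin)
    from counit_left_linear[OF this]
    show "tsum (\<Delta> y) (\<lambda>y' b'. sH (\<epsilon> x' * \<epsilon> y') (S b' * S a')) = sH (\<epsilon> x') (S y * S a')"
      by (simp add: vsubD(6)[OF vsub_H] mult.commute)
  qed
  also have "\<dots> = S y * S x"
    by (rule counit_left_linear) (auto intro!: lin)
  finally show ?thesis using 1 by simp
qed

text \<open>\<open>\<Delta>(S h) = S(h\<^sub>2) \<otimes> S(h\<^sub>1)\<close>. Dually to \<open>antipode_mult\<close>, both sides equal
  \<open>\<Delta>(S h\<^sub>1) \<Delta>(h\<^sub>2) (S(h\<^sub>4) \<otimes> S(h\<^sub>3))\<close>.\<close>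

lemma antipode_comult:
  assumes F: "bilin sH UNIV sH t W F" and W: "vsub t W"
  shows "tsum (\<Delta> (S h)) F = tsum (\<Delta> h) (\<lambda>a b. F (S b) (S a))"
proof -
  note [lin] = bilin_linear[OF F] W
  define P where "P h1 k1 k2 = tsum (\<Delta> (S h1)) (\<lambda>u1 u2. tsum (\<Delta> k1) (\<lambda>d1 d2.
    tsum (\<Delta> k2) (\<lambda>e1 e2. F (u1 * d1 * S e2) (u2 * d2 * S e1))))" for h1 k1 k2
  define K where "K k p q = tsum (\<Delta> k) (\<lambda>e1 e2. F (p * S e2) (q * S e1))" for k p q
  have FW: "F p q \<in> W" for p q using bilinD(3)[OF F] by simp
  have Fs: "F p (sH c q) = t c (F p q)" for p q c
    using linear_onD(3)[OF bilinD(2)[OF F]] by simp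
  have trilinP: "trilin sH UNIV sH t W P"
    unfolding P_def by (auto intro!: trilinI lin bilinI)
  have bilinK: "bilin sH UNIV sH t W (K k)" for k
    unfolding K_def by (auto intro!: lin bilinI)

  \<comment> \<open>\<open>\<Delta>(k\<^sub>1) (S(k\<^sub>3) \<otimes> S(k\<^sub>2)) = \<epsilon>(k)\<close>, multiplied by \<open>u\<^sub>1 \<otimes> u\<^sub>2\<close> from the left.\<close>
  have four: "tsum (\<Delta> k) (\<lambda>k1 k2. tsum (\<Delta> k1) (\<lambda>d1 d2. tsum (\<Delta> k2) (\<lambda>e1 e2.
      F (u1 * d1 * S e2) (u2 * d2 * S e1)))) = t (\<epsilon> k) (F u1 u2)" for u1 u2 k
  proof -
    have "tsum (\<Delta> k) (\<lambda>k1 k2. tsum (\<Delta> k1) (\<lambda>d1 d2. tsum (\<Delta> k2) (\<lambda>e1 e2.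
        F (u1 * d1 * S e2) (u2 * d2 * S e1))))
      = tsum (\<Delta> k) (\<lambda>k1 k2. tsum (\<Delta> k2) (\<lambda>d2 q. tsum (\<Delta> q) (\<lambda>e1 e2.
        F (u1 * k1 * S e2) (u2 * d2 * S e1))))"
      by (rule comult_coassoc) (auto intro!: trilinI lin bilinI)
    also have "\<dots> = tsum (\<Delta> k) (\<lambda>k1 k2. tsum (\<Delta> k2) (\<lambda>q e2. tsum (\<Delta> q) (\<lambda>d2 e1.
        F (u1 * k1 * S e2) (u2 * d2 * S e1))))"
      by (intro tsum_cong[OF HOL.refl] comult_coassoc[symmetric]) (auto intro!: trilinI lin bilinI)
    also have "\<dots> = tsum (\<Delta> k) (\<lambda>k1 k2. F (u1 * k1 * S k2) u2)"
    proof (intro tsum_cong[OF HOL.refl])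
      fix k1 k2
      have "tsum (\<Delta> q) (\<lambda>d2 e1. F (u1 * k1 * S e2) (u2 * d2 * S e1))
          = t (\<epsilon> q) (F (u1 * k1 * S e2) u2)" for q e2
      proof -
        have "tsum (\<Delta> q) (\<lambda>d2 e1. F (u1 * k1 * S e2) (u2 * d2 * S e1))
            = F (u1 * k1 * S e2) (tsum (\<Delta> q) (\<lambda>d2 e1. u2 * (d2 * S e1)))"
          by (subst linear_on_tsum[OF bilinD(2)[OF F] vsub_H]) (auto simp: mult.assoc)
        then show ?thesis
          by (simp add: tsum_mult_left[symmetric] antipode_right scale_mult Fs)
      qed
      moreover have "linear_on sH UNIV t W (\<lambda>e2. F (u1 * k1 * S e2) u2)"
        by (auto intro!: lin)
      note counit_left_linear[OF this, of k2]
      ultimately show "tsum (\<Delta> k2) (\<lambda>q e2. tsum (\<Delta> q) (\<lambda>d2 e1.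
          F (u1 * k1 * S e2) (u2 * d2 * S e1))) = F (u1 * k1 * S k2) u2"
        by simp
    qed
    also have "\<dots> = F (tsum (\<Delta> k) (\<lambda>k1 k2. u1 * (k1 * S k2))) u2"
      by (subst linear_on_tsum[OF bilinD(1)[OF F] vsub_H]) (auto simp: mult.assoc)
    also have "\<dots> = t (\<epsilon> k) (F u1 u2)"
      using linear_onD(3)[OF bilinD(1)[OF F]]
      by (simp add: tsum_mult_left[symmetric] antipode_right scale_mult)
    finally show ?thesis .
  qed

  have "tsum (\<Delta> h) (\<lambda>h1 k. tsum (\<Delta> k) (\<lambda>k1 k2. P h1 k1 k2))
    = tsum (\<Delta> h) (\<lambda>h1 k. t (\<epsilon> k) (tsum (\<Delta> (S h1)) F))"
  proof (intro tsum_cong[OF HOL.refl])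
    fix h1 k
    have "tsum (\<Delta> k) (\<lambda>k1 k2. P h1 k1 k2) = tsum (\<Delta> (S h1)) (\<lambda>u1 u2. t (\<epsilon> k) (F u1 u2))"
      unfolding P_def by (subst tsum_swap) (simp add: four)
    also have "\<dots> = t (\<epsilon> k) (tsum (\<Delta> (S h1)) F)"
      by (rule tsum_scale[OF W FW])
    finally show "tsum (\<Delta> k) (\<lambda>k1 k2. P h1 k1 k2) = \<dots>" .
  qed
  also have "\<dots> = tsum (\<Delta> (S h)) F"
    by (rule counit_right) (auto intro!: lin F)
  finally have 1: "tsum (\<Delta> h) (\<lambda>h1 k. tsum (\<Delta> k) (\<lambda>k1 k2. P h1 k1 k2)) = tsum (\<Delta> (S h)) F" .

  have "tsum (\<Delta> h) (\<lambda>h1 k. tsum (\<Delta> k) (\<lambda>k1 k2. P h1 k1 k2))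
    = tsum (\<Delta> h) (\<lambda>g k2. tsum (\<Delta> g) (\<lambda>h1 k1. P h1 k1 k2))"
    by (rule comult_coassoc[symmetric, OF trilinP])
  also have "\<dots> = tsum (\<Delta> h) (\<lambda>g k2. t (\<epsilon> g) (K k2 1 1))"
  proof (intro tsum_cong[OF HOL.refl])
    fix g k2
    have "P h1 k1 k2 = tsum (\<Delta> (S h1 * k1)) (K k2)" for h1 k1
      unfolding comult_mult[OF bilinK] by (simp add: P_def K_def)
    then have "tsum (\<Delta> g) (\<lambda>h1 k1. P h1 k1 k2)
        = tsum (\<Delta> (tsum (\<Delta> g) (\<lambda>h1 k1. S h1 * k1))) (K k2)"
      by (simp add: linear_on_tsum[OF comult_linear[OF bilinK W linear_on_ident] vsub_H])
    also have "\<dots> = t (\<epsilon> g) (tsum (\<Delta> 1) (K k2))"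
      using linear_onD(3)[OF comult_linear[OF bilinK W linear_on_ident]] by (simp add: antipode_left)
    finally show "tsum (\<Delta> g) (\<lambda>h1 k1. P h1 k1 k2) = t (\<epsilon> g) (K k2 1 1)"
      by (simp add: comult_one[OF bilinK])
  qed
  also have "\<dots> = K h 1 1"
    unfolding K_def by (rule counit_left_linear) (auto intro!: lin bilinI)
  finally show ?thesis using 1 by (simp add: K_def)
qed

end

locale hopf_alg_bij = hopf_alg +
  assumes bij_antipode: "bij S"
begin

text \<open>\<open>T\<close> is the inverse of the antipode; it is an antipode for the opposite comultiplication.\<close>

definition T where "T = inv S"

lemma S_T [simp]: "S (T x) = x" and T_S [simp]: "T (S x) = x"
  using bij_antipode by (simp_all add: T_def bij_is_surj surj_f_inv_f bij_is_inj)

lemma S_eq_iff: "S x = S y \<longleftrightarrow> x = y"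
  using T_S by metis

lemma T_linear [lin]:
  assumes "linear_on s V sH UNIV f" shows "linear_on s V sH UNIV (\<lambda>x. T (f x))"
proof (rule linear_on_comp[OF _ assms], rule linear_onI)
  note S = linear_onD(2)[OF antipode_linear[OF linear_on_ident]]
  show "T (v + w) = T v + T w" for v w
    by (rule S_eq_iff[THEN iffD1]) (simp add: S)
  show "T (sH c v) = sH c (T v)" for c v
    by (rule S_eq_iff[THEN iffD1]) (simp add: antipode_scale)
qed auto

lemma T_mult: "T (x * y) = T y * T x"
  by (rule S_eq_iff[THEN iffD1]) (simp add: antipode_mult)

lemma T_left: "tsum (\<Delta> h) (\<lambda>a b. T b * a) = sH (\<epsilon> h) 1"
proof -
  have "S (tsum (\<Delta> h) (\<lambda>a b. T b * a)) = S (sH (\<epsilon> h) 1)"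
    by (subst linear_on_tsum[OF antipode_linear[OF linear_on_ident] vsub_H])
      (simp_all add: antipode_mult antipode_left antipode_scale antipode_one)
  then show ?thesis by (simp add: S_eq_iff)
qed

lemma T_right: "tsum (\<Delta> h) (\<lambda>a b. b * T a) = sH (\<epsilon> h) 1"
proof -
  have "S (tsum (\<Delta> h) (\<lambda>a b. b * T a)) = S (sH (\<epsilon> h) 1)"
    by (subst linear_on_tsum[OF antipode_linear[OF linear_on_ident] vsub_H])
      (simp_all add: antipode_mult antipode_right antipode_scale antipode_one)
  then show ?thesis by (simp add: S_eq_iff)
qed

lemma T_comult:
  assumes F: "bilin sH UNIV sH t W F" and W: "vsub t W"
  shows "tsum (\<Delta> (T h)) F = tsum (\<Delta> h) (\<lambda>a b. F (T b) (T a))"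
proof -
  note [lin] = bilin_linear[OF F]
  have "bilin sH UNIV sH t W (\<lambda>a b. F (T b) (T a))" by (auto intro!: lin bilinI)
  from antipode_comult[OF this W, of "T h"] show ?thesis by simp
qed

end


section \<open>Actions compatible with coactions\<close>

text \<open>A bilinear action of \<open>A\<close> on \<open>V\<close> compatible with the coactions. No law of associativity or
  Lie type is required, so that \<open>act\<close> and \<open>lact\<close> can be treated alike.\<close>

definition comodule_action where
  "comodule_action H A s V \<rho> op \<longleftrightarrow>
     bilinear_action (ascale A) s V op \<and>
     (\<forall>a. \<forall>m\<in>V. tensor_eq s (hscale H) V (\<rho> (op a m)) (tensor_op op (acoact A a) (\<rho> m)))"

lemma bilinear_action_linear:
  assumes "bilinear_action sA s V op"
  shows "linear_on s' V' s V f \<Longrightarrow> linear_on s' V' s V (\<lambda>x. op a (f x))"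
    and "linear_on s' V' sA UNIV g \<Longrightarrow> m \<in> V \<Longrightarrow> linear_on s' V' s V (\<lambda>x. op (g x) m)"
    and "m \<in> V \<Longrightarrow> op a m \<in> V"
proof -
  have 1: "linear_on s V s V (op a)" for a using assms by (simp add: bilinear_action_def)
  have 2: "linear_on sA UNIV s V (\<lambda>a. op a m)" if "m \<in> V" for m
    using assms that by (simp add: bilinear_action_def)
  show "linear_on s' V' s V f \<Longrightarrow> linear_on s' V' s V (\<lambda>x. op a (f x))"
    by (rule linear_on_comp[OF 1])
  show "linear_on s' V' sA UNIV g \<Longrightarrow> m \<in> V \<Longrightarrow> linear_on s' V' s V (\<lambda>x. op (g x) m)"
    by (rule linear_on_comp[OF 2])
  show "m \<in> V \<Longrightarrow> op a m \<in> V" by (rule linear_onD(1)[OF 1])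
qed

lemma tsum_zero [simp]: "tsum x (\<lambda>_ _. 0) = 0"
  by (induction x) auto

lemma linear_on_restrict:
  "linear_on s V t W f \<Longrightarrow> K \<subseteq> V \<Longrightarrow> (\<And>v. v \<in> K \<Longrightarrow> f v \<in> L) \<Longrightarrow> linear_on s K t L f"
  by (rule linear_onI) (auto simp: linear_onD subset_iff)

context hopf_alg
begin

lemma colinear_tsum:
  assumes f: "colinear H V \<rho> t W \<sigma> f" and W: "vsub t W" and F: "bilin t W sH u U F" and v: "v \<in> V"
  shows "tsum (\<sigma> (f v)) F = tsum (\<rho> v) (\<lambda>x h. F (f x) h)"
proof -
  have "tensor_eq t sH W (\<sigma> (f v)) {#(f x, h). (x, h) \<in># \<rho> v#}"
    using f v by (simp add: colinear_def)
  from tensor_eq_tsum[OF this F W] show ?thesis by simp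
qed

lemma bilin_functional:
  assumes "vsub s V" "linear_on sH UNIV (*) UNIV \<chi>"
  shows "bilin s V sH s V (\<lambda>v h. s (\<chi> h) v)"
  by (intro bilinI lin assms)

text \<open>It suffices to test colinearity on bilinear maps; those of the form \<open>v \<otimes> h \<mapsto> \<chi>(h) v\<close> are used.\<close>

lemma colinearI:
  assumes \<rho>: "right_comodule H s V \<rho>" and \<sigma>: "right_comodule H t W \<sigma>"
    and f: "\<And>v. v \<in> V \<Longrightarrow> f v \<in> W"
    and eq: "\<And>v F. v \<in> V \<Longrightarrow> bilin t W sH t W F \<Longrightarrow>
      tsum (\<sigma> (f v)) F = tsum (\<rho> v) (\<lambda>x h. F (f x) h)"
  shows "colinear H V \<rho> t W \<sigma> f"
  unfolding colinear_def
proof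
  fix v assume v: "v \<in> V"
  note W = comodule_vsub[OF \<sigma>]
  show "tensor_eq t sH W (\<sigma> (f v)) {#(f x, h). (x, h) \<in># \<rho> v#}"
  proof (rule tensor_eqI[OF W vsub_H])
    show "set_mset (\<sigma> (f v)) \<subseteq> W \<times> UNIV"
      using comodule_mem[OF \<sigma>] f[OF v] by auto
    show "set_mset {#(f x, h). (x, h) \<in># \<rho> v#} \<subseteq> W \<times> UNIV"
      using comodule_mem[OF \<rho> _ v] f by auto
    show "tsum (\<sigma> (f v)) (\<lambda>w h. t (\<chi> h) w) =
        tsum {#(f x, h). (x, h) \<in># \<rho> v#} (\<lambda>w h. t (\<chi> h) w)"
      if "linear_on sH UNIV (*) UNIV \<chi>" for \<chi>
      using eq[OF v bilin_functional[OF W that]] by simp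
  qed
qed

lemma comodule_action_tsum:
  assumes "comodule_action H A s V \<rho> op" and "bilin s V sH t W F" and "vsub s V" and "m \<in> V"
  shows "tsum (\<rho> (op a m)) F =
    tsum (acoact A a) (\<lambda>b k. tsum (\<rho> m) (\<lambda>n h. F (op b n) (k * h)))"
proof -
  have "tensor_eq s sH V (\<rho> (op a m)) (tensor_op op (acoact A a) (\<rho> m))"
    using assms(1,4) by (simp add: comodule_action_def)
  from tensor_eq_tsum[OF this assms(2,3)] show ?thesis by (simp add: tsum_tensor_op)
qed


section \<open>Monomorphisms are injective\<close>

text \<open>Expand \<open>\<rho> x = \<Sum>\<^sub>b c\<^sub>b \<otimes> b\<close> along a basis of \<open>H\<close>. By colinearity \<open>f(c\<^sub>b)\<close> is a coordinate of the
  coaction of \<open>f(x) = 0\<close>, so all \<open>c\<^sub>b\<close> lie in the kernel.\<close>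

lemma kernel_coaction_exists:
  assumes \<rho>: "right_comodule H s V \<rho>" and \<sigma>: "right_comodule H t W \<sigma>"
    and f: "linear_on s V t W f" and col: "colinear H V \<rho> t W \<sigma> f"
    and x: "x \<in> V" "f x = 0"
  shows "\<exists>r. set_mset r \<subseteq> {x \<in> V. f x = 0} \<times> UNIV \<and> tensor_eq s sH V r (\<rho> x)"
proof -
  note V = comodule_vsub[OF \<rho>] and W = comodule_vsub[OF \<sigma>]
  have "vector_space sH" using vsub_H by (simp add: vsub_def)
  moreover have "finite (snd ` set_mset (\<rho> x))" by simp
  ultimately obtain E r where E: "finite E" and r: "\<And>b. linear_on sH UNIV (*) UNIV (r b)"
    "\<And>h. h \<in> snd ` set_mset (\<rho> x) \<Longrightarrow> h = (\<Sum>b\<in>E. sH (r b h) b)"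
    by (rule finite_coordinates) blast
  define c where "c b = tsum (\<rho> x) (\<lambda>v h. s (r b h) v)" for b
  have mem: "v \<in> V" if "(v, h) \<in># \<rho> x" for v h using comodule_mem[OF \<rho> that x(1)] .
  have "tensor_eq s sH V (\<rho> x) (\<Sum>b\<in>E. {#(c b, b)#})"
    unfolding c_def
  proof (rule tensor_normal_form[OF V vsub_H E])
    show "h = (\<Sum>b\<in>E. sH (r b h) b)" if "(v, h) \<in># \<rho> x" for v h
      by (rule r(2)) (use that in force)
  qed (use mem in auto)
  then have "tensor_eq s sH V (\<Sum>b\<in>E. {#(c b, b)#}) (\<rho> x)"
    unfolding tensor_eq_def by (rule sum_cong.sym)
  moreover have "c b \<in> V" for b
    unfolding c_def by (rule tsum_in[OF V]) (rule vsubD(3)[OF V mem])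
  moreover have "f (c b) = 0" for b
  proof -
    note F = bilin_functional[OF W r(1)]
    have "f (c b) = tsum (\<rho> x) (\<lambda>v h. f (s (r b h) v))"
      unfolding c_def by (rule linear_on_tsum[OF f V]) (rule vsubD(3)[OF V mem])
    also have "\<dots> = tsum (\<rho> x) (\<lambda>v h. t (r b h) (f v))"
      by (rule tsum_cong[OF HOL.refl]) (rule linear_onD(3)[OF f mem])
    also have "\<dots> = tsum (\<sigma> (f x)) (\<lambda>v h. t (r b h) v)"
      by (rule colinear_tsum[symmetric, OF col W F x(1)])
    also have "\<dots> = 0"
      unfolding x(2) by (rule linear_on_0[OF comodule_linear[OF \<sigma> F W linear_on_ident] vsubD(1)[OF W]])
    finally show ?thesis .
  qed
  moreover have "set_mset (\<Sum>b\<in>E. {#(c b, b)#}) = (\<lambda>b. (c b, b)) ` E"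
    using E by (induction E) auto
  ultimately show ?thesis by (intro exI[of _ "\<Sum>b\<in>E. {#(c b, b)#}"]) auto
qed

text \<open>A coaction of \<open>V\<close> whose values on a subspace \<open>K\<close> can be represented in \<open>K \<otimes> H\<close> restricts to
  \<open>K\<close>. The axioms hold in \<open>V \<otimes> H\<close> and are transported to \<open>K \<otimes> H\<close> by testing on functionals.\<close>

lemma subcomodule:
  assumes \<rho>: "right_comodule H s V \<rho>" and K: "vsub s K" "K \<subseteq> V"
    and set: "\<forall>x\<in>K. set_mset (\<rho>K x) \<subseteq> K \<times> UNIV"
    and eq: "\<forall>x\<in>K. tensor_eq s sH V (\<rho>K x) (\<rho> x)"
  shows "right_comodule H s K \<rho>K"
    and "\<And>t W F x. bilin s V sH t W F \<Longrightarrow> x \<in> K \<Longrightarrow> tsum (\<rho>K x) F = tsum (\<rho> x) F"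
proof -
  note V = comodule_vsub[OF \<rho>]
  show eval_K: "tsum (\<rho>K x) F = tsum (\<rho> x) F" if F: "bilin s V sH t W F" and x: "x \<in> K"
    for t :: "'k \<Rightarrow> 'w::ab_group_add \<Rightarrow> 'w" and W F x
    by (rule tensor_eq_tsum[OF _ F V]) (use eq x in blast)
  have \<rho>K: "set_mset (\<rho>K x) \<subseteq> K \<times> UNIV" if "x \<in> K" for x
    using set that by blast
  have mem: "y \<in> K" if "(y, h) \<in># \<rho>K x" "x \<in> K" for x y h
    using \<rho>K that by blast
  have KV: "x \<in> V" if "x \<in> K" for x using K(2) that by blast
  note [lin] = V
  note lin_\<rho> [lin] = comodule_linear[OF \<rho>]
  show "right_comodule H s K \<rho>K"
    unfolding right_comodule_def
  proof (intro conjI allI ballI)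
    show "vector_space s" "module.subspace s K" using K(1) by (auto simp: vsub_def)
    show "set_mset (\<rho>K v) \<subseteq> K \<times> UNIV" if "v \<in> K" for v using \<rho>K that .
    show "tensor_eq s sH K (\<rho>K (v + w)) (\<rho>K v + \<rho>K w)" if vw: "v \<in> K" "w \<in> K" for v w
    proof (rule tensor_eqI[OF K(1) vsub_H])
      have K': "v + w \<in> K" using vsubD(2)[OF K(1)] vw by blast
      then show "set_mset (\<rho>K (v + w)) \<subseteq> K \<times> UNIV" by (rule \<rho>K)
      show "set_mset (\<rho>K v + \<rho>K w) \<subseteq> K \<times> UNIV" using \<rho>K vw by auto
      fix \<chi> assume \<chi>: "linear_on sH UNIV (*) UNIV \<chi>"
      note F = bilin_functional[OF V \<chi>]
      show "tsum (\<rho>K (v + w)) (\<lambda>v h. s (\<chi> h) v) = tsum (\<rho>K v + \<rho>K w) (\<lambda>v h. s (\<chi> h) v)"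
        using linear_onD(2)[OF lin_\<rho>[OF F V linear_on_ident]] KV vw
        by (simp add: eval_K[OF F] K')
    qed
    show "tensor_eq s sH K (\<rho>K (s c v)) {#(s c x, h). (x, h) \<in># \<rho>K v#}" if v: "v \<in> K" for c v
    proof (rule tensor_eqI[OF K(1) vsub_H])
      have K': "s c v \<in> K" using vsubD(3)[OF K(1)] v by blast
      then show "set_mset (\<rho>K (s c v)) \<subseteq> K \<times> UNIV" by (rule \<rho>K)
      show "set_mset {#(s c x, h). (x, h) \<in># \<rho>K v#} \<subseteq> K \<times> UNIV"
        using mem[OF _ v] vsubD(3)[OF K(1)] by auto
      fix \<chi> assume \<chi>: "linear_on sH UNIV (*) UNIV \<chi>"
      note F = bilin_functional[OF V \<chi>]
      have "tsum (\<rho>K v) (\<lambda>x h. s (\<chi> h) (s c x)) = tsum (\<rho>K v) (\<lambda>x h. s c (s (\<chi> h) x))"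
        by (simp add: vsubD(6)[OF V] mult.commute)
      also have "\<dots> = s c (tsum (\<rho>K v) (\<lambda>x h. s (\<chi> h) x))"
        by (rule tsum_scale[OF V]) (use mem[OF _ v] KV vsubD(3)[OF V] in blast)
      finally show "tsum (\<rho>K (s c v)) (\<lambda>v h. s (\<chi> h) v) =
          tsum {#(s c x, h). (x, h) \<in># \<rho>K v#} (\<lambda>v h. s (\<chi> h) v)"
        using linear_onD(3)[OF lin_\<rho>[OF F V linear_on_ident]] KV v
        by (simp add: eval_K[OF F] K')
    qed
    show "(\<Sum>(x, h)\<in>#\<rho>K v. s (\<epsilon> h) x) = v" if v: "v \<in> K" for v
    proof -
      have "bilin s V sH s V (\<lambda>x h. s (\<epsilon> h) x)" by (intro bilinI lin)
      from eval_K[OF this v] have "tsum (\<rho>K v) (\<lambda>x h. s (\<epsilon> h) x) = v"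
        using comodule_counit[OF \<rho> linear_on_ident KV[OF v]] by simp
      then show ?thesis by (simp add: tsum_def)
    qed
    show "tensor3_eq s sH K
        (\<Sum>(x, h)\<in>#\<rho>K v. {#(y, g, h). (y, g) \<in># \<rho>K x#})
        (\<Sum>(x, h)\<in>#\<rho>K v. {#(x, h1, h2). (h1, h2) \<in># \<Delta> h#})" if v: "v \<in> K" for v
    proof (rule tensor3_eqI[OF K(1) vsub_H])
      show "set_mset (\<Sum>(x, h)\<in>#\<rho>K v. {#(y, g, h). (y, g) \<in># \<rho>K x#}) \<subseteq> K \<times> UNIV"
        "set_mset (\<Sum>(x, h)\<in>#\<rho>K v. {#(x, h1, h2). (h1, h2) \<in># \<Delta> h#}) \<subseteq> K \<times> UNIV"
        using mem v by auto
      fix \<chi> \<psi> assume [lin]: "linear_on sH UNIV (*) UNIV \<chi>" "linear_on sH UNIV (*) UNIV \<psi>"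
      have [lin]: "linear_on sH UNIV (*) UNIV (\<lambda>h. \<chi> h * c)" "linear_on sH UNIV (*) UNIV (\<lambda>h. c * \<psi> h)" for c
        using \<open>linear_on sH UNIV (*) UNIV \<chi>\<close> \<open>linear_on sH UNIV (*) UNIV \<psi>\<close>
        by (simp_all add: linear_on_def algebra_simps)
      let ?F = "\<lambda>x h1 h2. s (\<chi> h1 * \<psi> h2) x"
      have nested: "(\<Sum>(v, h, g)\<in>#(\<Sum>(x, h)\<in>#z. f x h). ?F v h g)
          = tsum z (\<lambda>x h. \<Sum>(v, h, g)\<in>#f x h. ?F v h g)" for z and f :: "_ \<Rightarrow> _ \<Rightarrow> _ multiset"
        by (induction z) auto
      have inner: "(\<Sum>(v, h, g)\<in>#{#(y, g, h). (y, g) \<in># z#}. ?F v h g) = tsum z (\<lambda>y g. ?F y g h)"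
        "(\<Sum>(v, h, g)\<in>#{#(x, h1, h2). (h1, h2) \<in># z'#}. ?F v h g) = tsum z' (?F x)" for z z' h x
        by (induction z, auto) (induction z', auto)
      have "tsum (\<rho>K v) (\<lambda>x h. tsum (\<rho>K x) (\<lambda>y g. ?F y g h))
          = tsum (\<rho>K v) (\<lambda>x h. tsum (\<rho> x) (\<lambda>y g. ?F y g h))"
        by (intro tsum_cong[OF HOL.refl] eval_K) (auto intro!: bilinI lin dest: mem[OF _ v])
      also have "\<dots> = tsum (\<rho> v) (\<lambda>x h. tsum (\<rho> x) (\<lambda>y g. ?F y g h))"
        by (rule eval_K[OF _ v]) (auto intro!: bilinI lin dest: comodule_mem[OF \<rho>])
      also have "\<dots> = tsum (\<rho> v) (\<lambda>x h. tsum (\<Delta> h) (\<lambda>h1 h2. ?F x h1 h2))"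
        by (rule comodule_coassoc[OF \<rho> _ KV[OF v]]) (auto intro!: trilinI lin)
      also have "\<dots> = tsum (\<rho>K v) (\<lambda>x h. tsum (\<Delta> h) (\<lambda>h1 h2. ?F x h1 h2))"
        by (rule eval_K[symmetric, OF _ v]) (auto intro!: bilinI lin)
      finally show "(\<Sum>(v, h, g)\<in>#(\<Sum>(x, h)\<in>#\<rho>K v. {#(y, g, h). (y, g) \<in># \<rho>K x#}). ?F v h g) =
          (\<Sum>(v, h, g)\<in>#(\<Sum>(x, h)\<in>#\<rho>K v. {#(x, h1, h2). (h1, h2) \<in># \<Delta> h#}). ?F v h g)"
        unfolding nested inner .
    qed
  qed
qed

lemma subcomodule_action:
  assumes \<rho>: "right_comodule H s V \<rho>" and K: "vsub s K" "K \<subseteq> V"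
    and set: "\<forall>x\<in>K. set_mset (\<rho>K x) \<subseteq> K \<times> UNIV"
    and eq: "\<forall>x\<in>K. tensor_eq s sH V (\<rho>K x) (\<rho> x)"
    and op: "comodule_action H A s V \<rho> op" and closed: "\<And>a x. x \<in> K \<Longrightarrow> op a x \<in> K"
  shows "comodule_action H A s K \<rho>K op"
proof -
  note V = comodule_vsub[OF \<rho>]
  note eval_K = subcomodule(2)[OF \<rho> K set eq]
  have \<rho>K: "set_mset (\<rho>K x) \<subseteq> K \<times> UNIV" if "x \<in> K" for x
    using set that by blast
  have act: "bilinear_action (ascale A) s V op" using op by (simp add: comodule_action_def)
  note [lin] = V bilinear_action_linear(1,2)[OF act]
  have KV: "x \<in> V" if "x \<in> K" for x using K(2) that by blast
  show ?thesis
    unfolding comodule_action_def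
  proof (intro conjI allI ballI)
    show "bilinear_action (ascale A) s K op"
      unfolding bilinear_action_def
    proof (intro conjI allI ballI)
      show "linear_on s K s K (op a)" for a
        by (rule linear_on_restrict[OF _ K(2) closed]) (use act in \<open>auto simp: bilinear_action_def\<close>)
      show "linear_on (ascale A) UNIV s K (\<lambda>a. op a m)" if "m \<in> K" for m
        by (rule linear_on_restrict[OF _ subset_UNIV closed[OF that]])
          (use act KV[OF that] in \<open>auto simp: bilinear_action_def\<close>)
    qed
    fix a m assume m: "m \<in> K"
    show "tensor_eq s sH K (\<rho>K (op a m)) (tensor_op op (acoact A a) (\<rho>K m))"
    proof (rule tensor_eqI[OF K(1) vsub_H \<rho>K[OF closed[OF m]]])
      show "set_mset (tensor_op op (acoact A a) (\<rho>K m)) \<subseteq> K \<times> UNIV"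
        using \<rho>K[OF m] closed by (fastforce elim: tensor_op_mem)
      fix \<chi> assume \<chi> [lin]: "linear_on sH UNIV (*) UNIV \<chi>"
      have [lin]: "linear_on sH UNIV (*) UNIV (\<lambda>h. \<chi> (k * h))" for k
        by (rule linear_on_comp[OF \<chi>]) (intro lin)
      note F = bilin_functional[OF V \<chi>]
      have "tsum (\<rho>K (op a m)) (\<lambda>v h. s (\<chi> h) v)
          = tsum (acoact A a) (\<lambda>b k. tsum (\<rho> m) (\<lambda>n h. s (\<chi> (k * h)) (op b n)))"
        using comodule_action_tsum[OF op F V KV[OF m]] by (simp add: eval_K[OF F] closed m)
      also have "\<dots> = tsum (acoact A a) (\<lambda>b k. tsum (\<rho>K m) (\<lambda>n h. s (\<chi> (k * h)) (op b n)))"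
        by (intro tsum_cong[OF HOL.refl] eval_K[symmetric] m)
          (auto intro!: bilinI lin bilinear_action_linear(3)[OF act])
      finally show "tsum (\<rho>K (op a m)) (\<lambda>v h. s (\<chi> h) v)
          = tsum (tensor_op op (acoact A a) (\<rho>K m)) (\<lambda>v h. s (\<chi> h) v)"
        by (simp add: tsum_tensor_op)
    qed
  qed
qed

text \<open>The kernel of a linear colinear map \<open>f\<close> on \<open>X\<close>. The representing formal sums of its coaction
  must have their entries in the kernel, hence differ from those of \<open>X\<close>.\<close>

definition kernel_mod ::
  "('k, 'a, 'h, 'u::ab_group_add) tp_mod \<Rightarrow> ('u \<Rightarrow> 'w::zero) \<Rightarrow> ('k, 'a, 'h, 'u) tp_mod" where
  "kernel_mod X f = X\<lparr>carr := {x \<in> carr X. f x = 0},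
     coact := (\<lambda>x. SOME r. set_mset r \<subseteq> {x \<in> carr X. f x = 0} \<times> UNIV \<and>
       tensor_eq (scale X) sH (carr X) r (coact X x))\<rparr>"

lemma kernel_mod_simps [simp]:
  "carr (kernel_mod X f) = {x \<in> carr X. f x = 0}"
  "scale (kernel_mod X f) = scale X" "act (kernel_mod X f) = act X" "lact (kernel_mod X f) = lact X"
  by (simp_all add: kernel_mod_def)

lemma lie_comodule_iff:
  "lie_comodule H A M \<longleftrightarrow> lie_module A M \<and> right_comodule H (scale M) (carr M) (coact M) \<and>
     comodule_action H A (scale M) (carr M) (coact M) (lact M)"
  by (auto simp: lie_comodule_def comodule_action_def lie_module_def)

lemma tp_hopf_module_iff:
  "tp_hopf_module H A M \<longleftrightarrow> tp_module A M \<and> lie_comodule H A M \<and>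
     comodule_action H A (scale M) (carr M) (coact M) (act M)"
  by (auto simp: tp_hopf_module_def comodule_action_def tp_module_def)

text \<open>The last claim serves the module action of \<open>A\<close> on transposed Poisson Hopf modules.\<close>

lemma kernel_lie_comodule:
  fixes X :: "('k, 'a::{comm_ring, comm_monoid_mult}, 'h, 'u::ab_group_add) tp_mod"
    and Y :: "('k, 'a, 'h, 'w::ab_group_add) tp_mod"
  assumes X: "lie_comodule H A X" and Y: "lie_comodule H A Y" and f: "lie_comodule_hom H X Y f"
  defines "Z \<equiv> kernel_mod X f"
  shows "lie_comodule H A Z"
    and "lie_comodule_hom H Z X (\<lambda>x. x)" and "lie_comodule_hom H Z X (\<lambda>x. 0)"
    and "\<And>op op'. comodule_action H A (scale X) (carr X) (coact X) op \<Longrightarrow>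
      comodule_action H A (scale Y) (carr Y) (coact Y) op' \<Longrightarrow>
      (\<And>a x. x \<in> carr X \<Longrightarrow> f (op a x) = op' a (f x)) \<Longrightarrow>
      comodule_action H A (scale Z) (carr Z) (coact Z) op"
proof -
  let ?V = "carr X" and ?s = "scale X" and ?\<rho> = "coact X"
  let ?K = "{x \<in> carr X. f x = 0}"
  have \<rho>: "right_comodule H ?s ?V ?\<rho>" and \<sigma>: "right_comodule H (scale Y) (carr Y) (coact Y)"
    using X Y by (simp_all add: lie_comodule_def)
  have lin_f: "linear_on ?s ?V (scale Y) (carr Y) f" and lact_f: "\<And>a m. m \<in> ?V \<Longrightarrow> f (lact X a m) = lact Y a (f m)"
    and col: "colinear H ?V ?\<rho> (scale Y) (carr Y) (coact Y) f"
    using f by (auto simp: lie_comodule_hom_def lie_hom_def)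
  note V = comodule_vsub[OF \<rho>] and W = comodule_vsub[OF \<sigma>]
  have f0: "f 0 = 0" by (rule linear_on_0[OF lin_f vsubD(1)[OF V]])
  have K: "vsub ?s ?K"
  proof -
    have "vector_space ?s" using V by (simp add: vsub_def)
    moreover from this have "module ?s" by (simp add: module_iff_vector_space)
    moreover have "f (x + y) = 0" if "x \<in> ?K" "y \<in> ?K" for x y
      using linear_onD(2)[OF lin_f] that by simp
    moreover have "f (?s c x) = 0" if "x \<in> ?K" for x c
      using linear_onD(3)[OF lin_f] vsubD(9)[OF W] that by simp
    ultimately show ?thesis
      using vsubD(1-3)[OF V] by (auto simp: vsub_def module.subspace_def f0)
  qed
  have KV: "?K \<subseteq> ?V" by blast
  have "set_mset (coact Z x) \<subseteq> ?K \<times> UNIV \<and> tensor_eq ?s sH ?V (coact Z x) (?\<rho> x)" if "x \<in> ?K" for x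
    using someI_ex[OF kernel_coaction_exists[OF \<rho> \<sigma> lin_f col, of x]] that
    by (simp add: Z_def kernel_mod_def)
  then have set: "\<forall>x\<in>?K. set_mset (coact Z x) \<subseteq> ?K \<times> UNIV"
    and eq: "\<forall>x\<in>?K. tensor_eq ?s sH ?V (coact Z x) (?\<rho> x)"
    by blast+
  note \<rho>K = subcomodule(1)[OF \<rho> K KV set eq]
  note eval_K = subcomodule(2)[OF \<rho> K KV set eq]
  show action: "comodule_action H A (scale Z) (carr Z) (coact Z) op"
    if op: "comodule_action H A ?s ?V ?\<rho> op" and op': "comodule_action H A (scale Y) (carr Y) (coact Y) op'"
      and hom: "\<And>a x. x \<in> ?V \<Longrightarrow> f (op a x) = op' a (f x)" for op op'
  proof -
    have act: "bilinear_action (ascale A) ?s ?V op" "bilinear_action (ascale A) (scale Y) (carr Y) op'"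
      using op op' by (simp_all add: comodule_action_def)
    have "op' a 0 = 0" for a
      by (rule linear_on_0[OF bilinear_action_linear(1)[OF act(2) linear_on_ident] vsubD(1)[OF W]])
    then have "op a x \<in> ?K" if "x \<in> ?K" for a x
      using that bilinear_action_linear(3)[OF act(1)] hom by simp
    from subcomodule_action[OF \<rho> K KV set eq op this] show ?thesis by (simp add: Z_def)
  qed
  have lact: "comodule_action H A ?s ?V ?\<rho> (lact X)"
    "comodule_action H A (scale Y) (carr Y) (coact Y) (lact Y)"
    using X Y by (simp_all add: lie_comodule_iff)
  have actZ: "comodule_action H A (scale Z) (carr Z) (coact Z) (lact Z)"
    using action[OF lact lact_f] by (simp add: Z_def)
  have "lie_module A Z"
    unfolding lie_module_def
    using X K actZ by (auto simp: Z_def lie_comodule_def lie_module_def vsub_def comodule_action_def)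
  then show "lie_comodule H A Z"
    using \<rho>K actZ by (simp add: lie_comodule_iff Z_def)
  have "colinear H ?K (coact Z) ?s ?V ?\<rho> (\<lambda>x. x)"
    by (rule colinearI[OF \<rho>K \<rho>]) (blast, rule eval_K[symmetric])
  then show "lie_comodule_hom H Z X (\<lambda>x. x)"
    by (auto simp: lie_comodule_hom_def lie_hom_def Z_def linear_on_def)
  have "colinear H ?K (coact Z) ?s ?V ?\<rho> (\<lambda>x. 0)"
  proof (rule colinearI[OF \<rho>K \<rho>])
    show "0 \<in> ?V" by (rule vsubD(1)[OF V])
    fix v :: 'u and F :: "'u \<Rightarrow> 'h \<Rightarrow> 'u" assume F: "bilin ?s ?V sH ?s ?V F"
    have "tsum (?\<rho> 0) F = 0"
      by (rule linear_on_0[OF comodule_linear[OF \<rho> F V linear_on_ident] vsubD(1)[OF V]])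
    moreover have "F 0 = (\<lambda>_. 0)"
      by (rule ext) (rule linear_on_0[OF bilinD(1)[OF F] vsubD(1)[OF V]])
    ultimately show "tsum (?\<rho> 0) F = tsum (coact Z v) (\<lambda>x. F 0)" by simp
  qed
  moreover have "lact X a 0 = 0" for a
    using lact(1) linear_on_0[OF bilinear_action_linear(1)[OF _ linear_on_ident] vsubD(1)[OF V]]
    unfolding comodule_action_def by blast
  ultimately show "lie_comodule_hom H Z X (\<lambda>x. 0)"
    using vsubD(1)[OF V] vsubD(9)[OF V] by (auto simp: lie_comodule_hom_def lie_hom_def Z_def linear_on_def)
qed

lemma kernel_zero_inj:
  assumes V: "vsub s V" and f: "linear_on s V t W f" and K: "\<And>x. x \<in> V \<Longrightarrow> f x = 0 \<Longrightarrow> x = 0"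
  shows "inj_on f V"
proof (rule inj_onI)
  fix x y assume xy: "x \<in> V" "y \<in> V" "f x = f y"
  interpret vector_space s using V by (simp add: vsub_def)
  have y: "s (- 1) y \<in> V" using vsubD(3)[OF V] xy by blast
  have "f 0 = f (y + s (- 1) y)" by simp
  then have "f (s (- 1) y) = - f y"
    using linear_onD(2)[OF f xy(2) y] linear_on_0[OF f vsubD(1)[OF V]] by (simp add: eq_neg_iff_add_eq_0 add.commute)
  then have "f (x + s (- 1) y) = 0" using linear_onD(2)[OF f xy(1) y] xy(3) by simp
  then have "x + s (- 1) y = 0" by (rule K[rotated]) (rule vsubD(2)[OF V xy(1) y])
  then show "x = y" by simp
qed

text \<open>A monomorphism equalizes the inclusion of its kernel and the zero map. The kernel lives on the
  same type \<open>'u\<close> as \<open>X\<close> and \<open>Y\<close>, so it is among the test objects.\<close>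

lemma mono_lie_comodule_inj:
  fixes X Y :: "('k, 'a::{comm_ring, comm_monoid_mult}, 'h, 'u::ab_group_add) tp_mod"
  assumes X: "lie_comodule H A X" and Y: "lie_comodule H A Y"
    and i: "mono_in (lie_comodule H A) (lie_comodule_hom H) X Y i"
  shows "inj_on i (carr X)"
proof -
  have hom: "lie_comodule_hom H X Y i" using i by (simp add: mono_in_def)
  note ker = kernel_lie_comodule[OF X Y hom]
  have V: "vsub (scale X) (carr X)" using X comodule_vsub by (auto simp: lie_comodule_def)
  have lin_i: "linear_on (scale X) (carr X) (scale Y) (carr Y) i"
    using hom by (simp add: lie_comodule_hom_def lie_hom_def)
  have "z = 0" if "z \<in> carr (kernel_mod X i)" for z
    using conjunct2[OF i[unfolded mono_in_def], rule_format,
        of "kernel_mod X i" "\<lambda>x. x" "\<lambda>x. 0" z] ker(1-3) that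
      linear_on_0[OF lin_i vsubD(1)[OF V]] by simp
  then show ?thesis by (intro kernel_zero_inj[OF V lin_i]) simp
qed

lemma mono_tp_hopf_module_inj:
  fixes X Y :: "('k, 'a::{comm_ring, comm_monoid_mult}, 'h, 'u::ab_group_add) tp_mod"
  assumes X: "tp_hopf_module H A X" and Y: "tp_hopf_module H A Y"
    and i: "mono_in (tp_hopf_module H A) (tp_hopf_hom H) X Y i"
  shows "inj_on i (carr X)"
proof -
  let ?Z = "kernel_mod X i"
  have hom: "tp_hopf_hom H X Y i" using i by (simp add: mono_in_def)
  then have hom': "lie_comodule_hom H X Y i" and act_i: "\<And>a m. m \<in> carr X \<Longrightarrow> i (act X a m) = act Y a (i m)"
    by (auto simp: tp_hopf_hom_def lie_comodule_hom_def tp_hom_def)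
  have X': "lie_comodule H A X" "comodule_action H A (scale X) (carr X) (coact X) (act X)" "tp_module A X"
    and Y': "lie_comodule H A Y" "comodule_action H A (scale Y) (carr Y) (coact Y) (act Y)"
    using X Y by (simp_all add: tp_hopf_module_iff)
  note ker = kernel_lie_comodule[OF X'(1) Y'(1) hom']
  have act: "comodule_action H A (scale ?Z) (carr ?Z) (coact ?Z) (act ?Z)"
    using ker(4)[OF X'(2) Y'(2) act_i] by simp
  have V: "vsub (scale X) (carr X)" using X' comodule_vsub by (auto simp: lie_comodule_def)
  have lin_i: "linear_on (scale X) (carr X) (scale Y) (carr Y) i"
    using hom' by (simp add: lie_comodule_hom_def lie_hom_def)
  have Z: "tp_hopf_module H A ?Z"
    unfolding tp_hopf_module_iff
  proof (intro conjI ker(1) act)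
    show "tp_module A ?Z"
      unfolding tp_module_def
    proof (intro conjI)
      show "lie_module A ?Z" using ker(1) by (simp add: lie_comodule_def)
      show "bilinear_action (ascale A) (scale ?Z) (carr ?Z) (act ?Z)"
        using act by (simp add: comodule_action_def)
    qed (use X'(3) in \<open>auto simp: tp_module_def\<close>)
  qed
  have "act X a 0 = 0" for a
    using X'(2) linear_on_0[OF bilinear_action_linear(1)[OF _ linear_on_ident] vsubD(1)[OF V]]
    unfolding comodule_action_def by blast
  then have homs: "tp_hopf_hom H ?Z X (\<lambda>x. x)" "tp_hopf_hom H ?Z X (\<lambda>x. 0)"
    using ker(2,3) by (auto simp: tp_hopf_hom_def lie_comodule_hom_def tp_hom_def)
  have "z = 0" if "z \<in> carr ?Z" for z
    using conjunct2[OF i[unfolded mono_in_def], rule_format, of ?Z "\<lambda>x. x" "\<lambda>x. 0" z] Z homs that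
      linear_on_0[OF lin_i vsubD(1)[OF V]] by simp
  then show ?thesis by (intro kernel_zero_inj[OF V lin_i]) simp
qed

end


section \<open>Averaging along a total integral\<close>

text \<open>\<open>\<phi>\<close> is a total integral with values in the transposed Poisson center of \<open>A\<close>.\<close>

locale tp_integral = hopf_alg_bij H
  for H :: "('k::field_char_0, 'h::ring_1) hopf" +
  fixes A :: "('k, 'a::{comm_ring, comm_monoid_mult}, 'h) tp_alg"
    and M :: "('k, 'a, 'h, 'm::ab_group_add) tp_mod"
    and \<phi> :: "'h \<Rightarrow> 'a"
  assumes comodule_alg: "comodule_tp_algebra H A"
    and phi_lin: "Vector_Spaces.linear (hscale H) (ascale A) \<phi>"
    and phi_center: "range \<phi> \<subseteq> tp_center A"
    and phi_colinear: "colinear H UNIV (comult H) (ascale A) UNIV (acoact A) \<phi>"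
    and phi_one: "\<phi> 1 = 1"
    and hopf_mod: "tp_hopf_module H A M"
    and assoc: "associative_actions A M"
begin

abbreviation "sA \<equiv> ascale A"
abbreviation "V \<equiv> carr M"
abbreviation "s \<equiv> scale M"
abbreviation "\<rho> \<equiv> coact M"

lemma comodule_A: "right_comodule H sA UNIV (acoact A)"
  using comodule_alg by (simp add: comodule_tp_algebra_def)

lemma comodule_M: "right_comodule H s V \<rho>"
  and act_M: "comodule_action H A s V \<rho> (act M)"
  and lact_M: "comodule_action H A s V \<rho> (lact M)"
  and module_M: "tp_module A M"
  using hopf_mod by (simp_all add: tp_hopf_module_iff lie_comodule_iff)

lemma bilinear_act: "bilinear_action sA s V (act M)"
  and bilinear_lact: "bilinear_action sA s V (lact M)"
  using act_M lact_M by (simp_all add: comodule_action_def)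

lemma vsub_A [lin]: "vsub sA UNIV" and vsub_M [lin]: "vsub s V"
  using comodule_vsub comodule_A comodule_M by blast+

lemmas [lin] = comodule_linear[OF comodule_M] comodule_linear[OF comodule_A]
  bilinear_action_linear(1,2)[OF bilinear_act]

lemmas act_closed = bilinear_action_linear(3)[OF bilinear_act]

lemma phi_linear [lin]: "linear_on s' V' sH UNIV f \<Longrightarrow> linear_on s' V' sA UNIV (\<lambda>x. \<phi> (f x))"
  by (rule linear_on_comp[OF linear_on_UNIV[OF phi_lin]])

lemma algebra_A: "algebra_over sA"
  using comodule_alg by (simp add: comodule_tp_algebra_def transposed_poisson_algebra_def)

lemma phi_scale: "\<phi> (sH c x) = sA c (\<phi> x)"
  using linear_onD(3)[OF phi_linear[OF linear_on_ident]] by blast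

text \<open>\<open>\<phi>(k\<^sub>2 x T(k\<^sub>1)) = \<epsilon>(k) \<phi>(x)\<close>. This is the only place where commutativity of \<open>H\<close> or
  multiplicativity of \<open>\<phi>\<close> enters.\<close>

lemma phi_ad_invariant:
  assumes "(\<forall>x y :: 'h. x * y = y * x) \<or> (\<forall>x y. \<phi> (x * y) = \<phi> x * \<phi> y)"
  shows "tsum (\<Delta> k) (\<lambda>p q. \<phi> (q * x * T p)) = sA (\<epsilon> k) (\<phi> x)"
  using assms
proof
  assume comm: "\<forall>x y :: 'h. x * y = y * x"
  have "q * x * T p = x * (q * T p)" for p q
    using comm[rule_format, of q x] by (simp add: mult.assoc)
  then have "tsum (\<Delta> k) (\<lambda>p q. \<phi> (q * x * T p)) = \<phi> (x * tsum (\<Delta> k) (\<lambda>p q. q * T p))"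
    by (simp add: linear_on_tsum[OF phi_linear[OF linear_on_ident] vsub_H] tsum_mult_left)
  then show ?thesis by (simp add: T_right scale_mult phi_scale)
next
  assume alg: "\<forall>x y. \<phi> (x * y) = \<phi> x * \<phi> y"
  then have "\<phi> (q * x * T p) = \<phi> x * \<phi> (q * T p)" for p q
    by (simp add: mult_ac)
  then have "tsum (\<Delta> k) (\<lambda>p q. \<phi> (q * x * T p)) = \<phi> x * \<phi> (tsum (\<Delta> k) (\<lambda>p q. q * T p))"
    by (simp add: linear_on_tsum[OF phi_linear[OF linear_on_ident] vsub_H] tsum_mult_left)
  then show ?thesis
    using algebra_A by (simp add: T_right phi_scale phi_one algebra_over_def)
qed

lemma act_act_commute:
  assumes "m \<in> V" shows "act M a (act M (\<phi> x) m) = act M (\<phi> x) (act M a m)"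
proof -
  have "act M (a * \<phi> x) m = act M (\<phi> x * a) m" by (simp add: mult.commute)
  then show ?thesis using module_M assms by (simp add: tp_module_def)
qed

text \<open>Associativity turns \<open>2 b \<cdot> (a \<diamond> m) = (ba) \<diamond> m + a \<diamond> (b \<cdot> m)\<close> into
  \<open>b \<cdot> (a \<diamond> m) = a \<diamond> (b \<cdot> m)\<close> for central \<open>b\<close>.\<close>

lemma lact_act_commute:
  assumes m: "m \<in> V" shows "lact M a (act M (\<phi> x) m) = act M (\<phi> x) (lact M a m)"
proof -
  let ?v = "act M (\<phi> x) (lact M a m)"
  have "s 2 ?v = lact M (\<phi> x * a) m + lact M a (act M (\<phi> x) m)"
    using module_M m by (simp add: tp_module_def)
  also have "lact M (\<phi> x * a) m = ?v"
  proof -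
    have "\<phi> x \<in> tp_center A" using phi_center by blast
    then show ?thesis
      using assoc m unfolding associative_actions_def mult.commute[of "\<phi> x"] by blast
  qed
  also have "s 2 ?v = ?v + ?v"
    using vsubD(5)[OF vsub_M, of 1 1 ?v] by (simp add: vsubD(7)[OF vsub_M])
  finally show ?thesis by simp
qed

text \<open>The averaging map \<open>M \<otimes> H \<rightarrow> M\<close>, \<open>m \<otimes> h \<mapsto> \<phi>(h T(m\<^sub>1)) \<cdot> m\<^sub>0\<close>, as a bilinear function of \<open>m\<close> and
  \<open>h\<close>.\<close>

definition avg :: "'m \<Rightarrow> 'h \<Rightarrow> 'm" where
  "avg m h = tsum (\<rho> m) (\<lambda>n k. act M (\<phi> (h * T k)) n)"

lemma bilin_avg: "bilin s V sH s V avg"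
  unfolding avg_def by (auto intro!: bilinI lin dest: comodule_mem[OF comodule_M])

text \<open>\<open>avg\<close> is a retraction of the coaction \<open>M \<rightarrow> M \<otimes> H\<close>.\<close>

lemma avg_retraction:
  assumes m: "m \<in> V" shows "tsum (\<rho> m) avg = m"
proof -
  have unit: "act M 1 n = n" if "n \<in> V" for n
    using module_M that by (simp add: tp_module_def)
  have "tsum (\<rho> m) avg = tsum (\<rho> m) (\<lambda>n k. tsum (\<Delta> k) (\<lambda>p q. act M (\<phi> (q * T p)) n))"
    unfolding avg_def
    by (rule comodule_coassoc[OF comodule_M _ m]) (auto intro!: trilinI lin)
  also have "\<dots> = tsum (\<rho> m) (\<lambda>n k. s (\<epsilon> k) n)"
  proof (intro tsum_cong[OF HOL.refl])
    fix n k assume "(n, k) \<in># \<rho> m"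
    then have n: "n \<in> V" using comodule_mem[OF comodule_M _ m] by blast
    have L: "linear_on sH UNIV s V (\<lambda>z. act M (\<phi> z) n)" by (auto intro!: lin n)
    have "tsum (\<Delta> k) (\<lambda>p q. act M (\<phi> (q * T p)) n) = act M (\<phi> (tsum (\<Delta> k) (\<lambda>p q. q * T p))) n"
      by (rule linear_on_tsum[symmetric, OF L vsub_H UNIV_I])
    then show "tsum (\<Delta> k) (\<lambda>p q. act M (\<phi> (q * T p)) n) = s (\<epsilon> k) n"
      using linear_onD(3)[OF L, of 1] by (simp add: T_right phi_one unit n)
  qed
  also have "\<dots> = m" by (rule comodule_counit[OF comodule_M linear_on_ident m])
  finally show ?thesis .
qed

text \<open>\<open>avg\<close> is colinear if \<open>H\<close> coacts on \<open>M \<otimes> H\<close> through the second factor only: the coaction of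
  \<open>avg(m \<otimes> h)\<close> is \<open>\<phi>(h\<^sub>1 T(m\<^sub>3)) m\<^sub>0 \<otimes> h\<^sub>2 T(m\<^sub>2) m\<^sub>1\<close>, and \<open>T(m\<^sub>2) m\<^sub>1\<close> cancels.\<close>

lemma avg_colinear:
  assumes F: "bilin s V sH t W F" and W: "vsub t W" and m: "m \<in> V"
  shows "tsum (\<rho> (avg m h)) F = tsum (\<Delta> h) (\<lambda>h1 h2. F (avg m h1) h2)"
proof -
  note [lin] = bilin_linear[OF F] W
  note mem = comodule_mem[OF comodule_M]
  let ?X = "\<lambda>h1 h2 n q k1 k2. F (act M (\<phi> (h1 * T k2)) n) (h2 * T k1 * q)"
  have L: "linear_on s V t W (\<lambda>v. tsum (\<rho> v) F)" by (intro lin F)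
  have "tsum (\<rho> (avg m h)) F = tsum (\<rho> m) (\<lambda>n k. tsum (\<rho> (act M (\<phi> (h * T k)) n)) F)"
    unfolding avg_def by (rule linear_on_tsum[OF L vsub_M]) (rule act_closed[OF mem[OF _ m]])
  also have "\<dots> = tsum (\<rho> m) (\<lambda>n k. tsum (\<Delta> h) (\<lambda>h1 h2. tsum (\<rho> n) (\<lambda>n' q. tsum (\<Delta> k) (\<lambda>k1 k2.
      ?X h1 h2 n' q k1 k2))))"
  proof (intro tsum_cong[OF HOL.refl])
    fix n k assume "(n, k) \<in># \<rho> m"
    then have n: "n \<in> V" using mem[OF _ m] by blast
    define G where "G a p = tsum (\<rho> n) (\<lambda>n' q. F (act M a n') (p * q))" for a p
    have G: "bilin sA UNIV sH t W G"
      unfolding G_def by (auto intro!: bilinI lin act_closed dest: mem[OF _ n])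
    note [lin] = bilin_linear[OF G]
    have "tsum (\<rho> (act M (\<phi> (h * T k)) n)) F = tsum (acoact A (\<phi> (h * T k))) G"
      unfolding G_def by (rule comodule_action_tsum[OF act_M F vsub_M n])
    also have "\<dots> = tsum (\<Delta> (h * T k)) (\<lambda>x p. G (\<phi> x) p)"
      by (rule colinear_tsum[OF phi_colinear vsub_A G UNIV_I])
    also have "\<dots> = tsum (\<Delta> h) (\<lambda>h1 h2. tsum (\<Delta> (T k)) (\<lambda>b b'. G (\<phi> (h1 * b)) (h2 * b')))"
      by (rule comult_mult) (auto intro!: bilinI lin)
    also have "\<dots> = tsum (\<Delta> h) (\<lambda>h1 h2. tsum (\<Delta> k) (\<lambda>k1 k2. G (\<phi> (h1 * T k2)) (h2 * T k1)))"
      by (intro tsum_cong[OF HOL.refl] T_comult[OF _ W]) (auto intro!: bilinI lin)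
    also have "\<dots> = tsum (\<Delta> h) (\<lambda>h1 h2. tsum (\<rho> n) (\<lambda>n' q. tsum (\<Delta> k) (\<lambda>k1 k2.
        ?X h1 h2 n' q k1 k2)))"
      unfolding G_def by (intro tsum_cong[OF HOL.refl] tsum_swap)
    finally show "tsum (\<rho> (act M (\<phi> (h * T k)) n)) F = \<dots>" .
  qed
  also have "\<dots> = tsum (\<Delta> h) (\<lambda>h1 h2. tsum (\<rho> m) (\<lambda>n k. tsum (\<rho> n) (\<lambda>n' q. tsum (\<Delta> k) (\<lambda>k1 k2.
      ?X h1 h2 n' q k1 k2))))"
    by (rule tsum_swap)
  also have "\<dots> = tsum (\<Delta> h) (\<lambda>h1 h2. F (avg m h1) h2)"
  proof (intro tsum_cong[OF HOL.refl])
    fix h1 h2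
    have "tsum (\<rho> m) (\<lambda>n k. tsum (\<rho> n) (\<lambda>n' q. tsum (\<Delta> k) (\<lambda>k1 k2. ?X h1 h2 n' q k1 k2)))
        = tsum (\<rho> m) (\<lambda>n k. tsum (\<Delta> k) (\<lambda>q k'. tsum (\<Delta> k') (\<lambda>k1 k2. ?X h1 h2 n q k1 k2)))"
      by (rule comodule_coassoc[OF comodule_M _ m]) (auto intro!: trilinI bilinI lin act_closed)
    also have "\<dots> = tsum (\<rho> m) (\<lambda>n k. tsum (\<Delta> k) (\<lambda>k' k2. tsum (\<Delta> k') (\<lambda>q k1. ?X h1 h2 n q k1 k2)))"
      by (intro tsum_cong[OF HOL.refl] comult_coassoc[symmetric])
        (auto intro!: trilinI bilinI lin act_closed dest: mem[OF _ m])
    also have "\<dots> = tsum (\<rho> m) (\<lambda>n k. F (act M (\<phi> (h1 * T k)) n) h2)"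
    proof (intro tsum_cong[OF HOL.refl])
      fix n k assume "(n, k) \<in># \<rho> m"
      then have n: "n \<in> V" using mem[OF _ m] by blast
      have "tsum (\<Delta> k') (\<lambda>q k1. ?X h1 h2 n q k1 k2) = t (\<epsilon> k') (F (act M (\<phi> (h1 * T k2)) n) h2)" for k' k2
      proof -
        let ?v = "act M (\<phi> (h1 * T k2)) n"
        have v: "?v \<in> V" by (rule act_closed[OF n])
        have "tsum (\<Delta> k') (\<lambda>q k1. ?X h1 h2 n q k1 k2) = F ?v (tsum (\<Delta> k') (\<lambda>q k1. h2 * (T k1 * q)))"
          by (simp add: linear_on_tsum[OF bilinD(2)[OF F v] vsub_H] mult.assoc)
        then show ?thesis
          using linear_onD(3)[OF bilinD(2)[OF F v]]
          by (simp add: tsum_mult_left[symmetric] T_left scale_mult)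
      qed
      moreover have "linear_on sH UNIV t W (\<lambda>k2. F (act M (\<phi> (h1 * T k2)) n) h2)"
        by (auto intro!: lin n)
      note counit_left_linear[OF this, of k]
      ultimately show "tsum (\<Delta> k) (\<lambda>k' k2. tsum (\<Delta> k') (\<lambda>q k1. ?X h1 h2 n q k1 k2))
          = F (act M (\<phi> (h1 * T k)) n) h2" by simp
    qed
    also have "\<dots> = F (avg m h1) h2"
      unfolding avg_def by (rule linear_on_tsum[symmetric, OF bilinD(1)[OF F] vsub_M])
        (rule act_closed[OF mem[OF _ m]])
    finally show "tsum (\<rho> m) (\<lambda>n k. tsum (\<rho> n) (\<lambda>n' q. tsum (\<Delta> k) (\<lambda>k1 k2. ?X h1 h2 n' q k1 k2)))
        = F (avg m h1) h2" .
  qed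
  finally show ?thesis .
qed

text \<open>\<open>avg\<close> intertwines the diagonal action on \<open>M \<otimes> H\<close>, \<open>a(m \<otimes> h) = a\<^sub>0 m \<otimes> a\<^sub>1 h\<close>, with the
  action \<open>op\<close> on \<open>M\<close>, which may be either action of \<open>A\<close>.\<close>

lemma avg_equivariant:
  assumes op: "comodule_action H A s V \<rho> op"
    and commute: "\<And>a x m. m \<in> V \<Longrightarrow> op a (act M (\<phi> x) m) = act M (\<phi> x) (op a m)"
    and inv: "\<And>k x. tsum (\<Delta> k) (\<lambda>p q. \<phi> (q * x * T p)) = sA (\<epsilon> k) (\<phi> x)"
    and m: "m \<in> V"
  shows "tsum (acoact A a) (\<lambda>b k. avg (op b m) (k * h)) = op a (avg m h)"
proof -
  have bil: "bilinear_action sA s V op" using op by (simp add: comodule_action_def)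
  note [lin] = bilinear_action_linear(1,2)[OF bil]
  note op_closed = bilinear_action_linear(3)[OF bil]
  note mem = comodule_mem[OF comodule_M _ m]
  let ?Y = "\<lambda>b p q n r. act M (\<phi> (q * (h * T r) * T p)) (op b n)"
  have "tsum (acoact A a) (\<lambda>b k. avg (op b m) (k * h))
      = tsum (acoact A a) (\<lambda>b q. tsum (acoact A b) (\<lambda>b' p. tsum (\<rho> m) (\<lambda>n r. ?Y b' p q n r)))"
  proof (intro tsum_cong[OF HOL.refl])
    fix b q
    have "bilin s V sH s V (\<lambda>n k. act M (\<phi> (q * h * T k)) n)" by (auto intro!: bilinI lin)
    from comodule_action_tsum[OF op this vsub_M m, of b]
    show "avg (op b m) (q * h) = tsum (acoact A b) (\<lambda>b' p. tsum (\<rho> m) (\<lambda>n r. ?Y b' p q n r))"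
      by (simp add: avg_def T_mult mult.assoc)
  qed
  also have "\<dots> = tsum (acoact A a) (\<lambda>b k. tsum (\<Delta> k) (\<lambda>p q. tsum (\<rho> m) (\<lambda>n r. ?Y b p q n r)))"
    by (rule comodule_coassoc[OF comodule_A _ UNIV_I])
      (auto intro!: trilinI lin op_closed dest: mem)
  also have "\<dots> = tsum (acoact A a) (\<lambda>b k. tsum (\<rho> m) (\<lambda>n r. tsum (\<Delta> k) (\<lambda>p q. ?Y b p q n r)))"
    by (intro tsum_cong[OF HOL.refl] tsum_swap)
  also have "\<dots> = tsum (acoact A a) (\<lambda>b k. tsum (\<rho> m) (\<lambda>n r. s (\<epsilon> k) (act M (\<phi> (h * T r)) (op b n))))"
  proof (intro tsum_cong[OF HOL.refl])
    fix b k n r assume "(n, r) \<in># \<rho> m"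
    then have v: "op b n \<in> V" using mem op_closed by blast
    have L: "linear_on sA UNIV s V (\<lambda>z. act M z (op b n))" by (auto intro!: lin v)
    have "tsum (\<Delta> k) (\<lambda>p q. ?Y b p q n r) = act M (tsum (\<Delta> k) (\<lambda>p q. \<phi> (q * (h * T r) * T p))) (op b n)"
      by (rule linear_on_tsum[symmetric, OF L vsub_A UNIV_I])
    then show "tsum (\<Delta> k) (\<lambda>p q. ?Y b p q n r) = s (\<epsilon> k) (act M (\<phi> (h * T r)) (op b n))"
      using linear_onD(3)[OF L] by (simp add: inv)
  qed
  also have "\<dots> = tsum (\<rho> m) (\<lambda>n r. tsum (acoact A a) (\<lambda>b k. s (\<epsilon> k) (act M (\<phi> (h * T r)) (op b n))))"
    by (rule tsum_swap)
  also have "\<dots> = tsum (\<rho> m) (\<lambda>n r. op a (act M (\<phi> (h * T r)) n))"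
  proof (intro tsum_cong[OF HOL.refl])
    fix n r assume "(n, r) \<in># \<rho> m"
    then have n: "n \<in> V" using mem by blast
    have "linear_on sA UNIV s V (\<lambda>b. act M (\<phi> (h * T r)) (op b n))" by (auto intro!: lin n)
    from comodule_counit[OF comodule_A this UNIV_I, of a]
    show "tsum (acoact A a) (\<lambda>b k. s (\<epsilon> k) (act M (\<phi> (h * T r)) (op b n)))
        = op a (act M (\<phi> (h * T r)) n)" by (simp add: commute n)
  qed
  also have "\<dots> = op a (avg m h)"
    unfolding avg_def
    by (rule linear_on_tsum[symmetric, OF bilinear_action_linear(1)[OF bil linear_on_ident] vsub_M])
      (rule act_closed[OF mem])
  finally show ?thesis .
qed


section \<open>Averaging an extension\<close>

text \<open>The average \<open>y \<mapsto> avg(g(y\<^sub>0) \<otimes> y\<^sub>1)\<close> of a linear map \<open>g\<close> into \<open>M\<close> from a comodule with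
  coaction \<open>\<sigma>\<close>.\<close>

definition avg_map :: "('u \<Rightarrow> ('u \<times> 'h) multiset) \<Rightarrow> ('u \<Rightarrow> 'm) \<Rightarrow> 'u \<Rightarrow> 'm" where
  "avg_map \<sigma> g y = tsum (\<sigma> y) (\<lambda>z h. avg (g z) h)"

context
  fixes t :: "'k \<Rightarrow> 'u::ab_group_add \<Rightarrow> 'u" and W \<sigma> g
  assumes \<sigma>: "right_comodule H t W \<sigma>" and g: "linear_on t W s V g"
begin

lemma avg_map_bilin: "bilin t W sH s V (\<lambda>z h. avg (g z) h)"
proof -
  note [lin] = bilin_linear[OF bilin_avg] g
  show ?thesis by (auto intro!: bilinI lin linear_onD(1)[OF g])
qed

lemma avg_map_linear: "linear_on t W s V (avg_map \<sigma> g)"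
  unfolding avg_map_def by (rule comodule_linear[OF \<sigma> avg_map_bilin vsub_M linear_on_ident])

lemma avg_map_equivariant:
  assumes op': "comodule_action H A t W \<sigma> op'" and op: "comodule_action H A s V \<rho> op"
    and hom: "\<And>a y. y \<in> W \<Longrightarrow> g (op' a y) = op a (g y)"
    and commute: "\<And>a x m. m \<in> V \<Longrightarrow> op a (act M (\<phi> x) m) = act M (\<phi> x) (op a m)"
    and inv: "\<And>k x. tsum (\<Delta> k) (\<lambda>p q. \<phi> (q * x * T p)) = sA (\<epsilon> k) (\<phi> x)"
    and y: "y \<in> W"
  shows "avg_map \<sigma> g (op' a y) = op a (avg_map \<sigma> g y)"
proof -
  note mem = comodule_mem[OF \<sigma> _ y]
  have bil: "bilinear_action sA s V op" using op by (simp add: comodule_action_def)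
  have "avg_map \<sigma> g (op' a y) = tsum (acoact A a) (\<lambda>b k. tsum (\<sigma> y) (\<lambda>z h. avg (g (op' b z)) (k * h)))"
    unfolding avg_map_def
    by (rule comodule_action_tsum[OF op' avg_map_bilin comodule_vsub[OF \<sigma>] y])
  also have "\<dots> = tsum (acoact A a) (\<lambda>b k. tsum (\<sigma> y) (\<lambda>z h. avg (op b (g z)) (k * h)))"
    by (intro tsum_cong[OF HOL.refl]) (simp add: hom mem)
  also have "\<dots> = tsum (\<sigma> y) (\<lambda>z h. tsum (acoact A a) (\<lambda>b k. avg (op b (g z)) (k * h)))"
    by (rule tsum_swap)
  also have "\<dots> = tsum (\<sigma> y) (\<lambda>z h. op a (avg (g z) h))"
    by (intro tsum_cong[OF HOL.refl] avg_equivariant[OF op commute inv]) (use mem linear_onD(1)[OF g] in auto)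
  also have "\<dots> = op a (avg_map \<sigma> g y)"
    unfolding avg_map_def
    by (rule linear_on_tsum[symmetric, OF bilinear_action_linear(1)[OF bil linear_on_ident] vsub_M])
      (rule bilinD(3)[OF avg_map_bilin mem])
  finally show ?thesis .
qed

lemma avg_map_colinear: "colinear H W \<sigma> s V \<rho> (avg_map \<sigma> g)"
proof (rule colinearI[OF \<sigma> comodule_M linear_onD(1)[OF avg_map_linear]])
  fix y F assume y: "y \<in> W" and F: "bilin s V sH s V F"
  note [lin] = bilin_linear[OF bilin_avg] bilin_linear[OF F] g
  note mem = comodule_mem[OF \<sigma> _ y]
  note avg_closed = bilinD(3)[OF bilin_avg]
  have L: "linear_on s V s V (\<lambda>v. tsum (\<rho> v) F)" by (intro lin F)
  have "tsum (\<rho> (avg_map \<sigma> g y)) F = tsum (\<sigma> y) (\<lambda>z h. tsum (\<rho> (avg (g z) h)) F)"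
    unfolding avg_map_def by (rule linear_on_tsum[OF L vsub_M]) (rule bilinD(3)[OF avg_map_bilin mem])
  also have "\<dots> = tsum (\<sigma> y) (\<lambda>z h. tsum (\<Delta> h) (\<lambda>h1 h2. F (avg (g z) h1) h2))"
    by (intro tsum_cong[OF HOL.refl] avg_colinear[OF F vsub_M]) (use mem linear_onD(1)[OF g] in blast)
  also have "\<dots> = tsum (\<sigma> y) (\<lambda>z h. tsum (\<sigma> z) (\<lambda>w k. F (avg (g w) k) h))"
    by (rule comodule_coassoc[symmetric, OF \<sigma> _ y])
      (auto intro!: trilinI lin avg_closed linear_onD(1)[OF g])
  also have "\<dots> = tsum (\<sigma> y) (\<lambda>z h. F (avg_map \<sigma> g z) h)"
  proof (intro tsum_cong[OF HOL.refl])
    fix z h assume "(z, h) \<in># \<sigma> y"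
    then have z: "z \<in> W" by (rule mem)
    show "tsum (\<sigma> z) (\<lambda>w k. F (avg (g w) k) h) = F (avg_map \<sigma> g z) h"
      unfolding avg_map_def
      by (rule linear_on_tsum[symmetric, OF bilinD(1)[OF F] vsub_M])
        (rule bilinD(3)[OF avg_map_bilin comodule_mem[OF \<sigma> _ z]])
  qed
  finally show "tsum (\<rho> (avg_map \<sigma> g y)) F = tsum (\<sigma> y) (\<lambda>x h. F (avg_map \<sigma> g x) h)" .
qed

text \<open>Averaging does not disturb \<open>g\<close> where it is already colinear.\<close>

lemma avg_map_extends:
  assumes \<tau>: "right_comodule H u U \<tau>" and i: "colinear H U \<tau> t W \<sigma> i"
    and f: "colinear H U \<tau> s V \<rho> f" "\<And>x. x \<in> U \<Longrightarrow> f x \<in> V"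
    and gi: "\<And>x. x \<in> U \<Longrightarrow> g (i x) = f x" and x: "x \<in> U"
  shows "avg_map \<sigma> g (i x) = f x"
proof -
  have "avg_map \<sigma> g (i x) = tsum (\<tau> x) (\<lambda>z h. avg (g (i z)) h)"
    unfolding avg_map_def
    by (rule colinear_tsum[OF i comodule_vsub[OF \<sigma>] avg_map_bilin x])
  also have "\<dots> = tsum (\<tau> x) (\<lambda>z h. avg (f z) h)"
    by (intro tsum_cong[OF HOL.refl]) (simp add: gi comodule_mem[OF \<tau> _ x])
  also have "\<dots> = tsum (\<rho> (f x)) avg"
    by (rule colinear_tsum[symmetric, OF f(1) vsub_M bilin_avg x])
  finally show ?thesis using avg_retraction f(2)[OF x] by simp
qed

end

lemma mono_in_injI:
  assumes "Hom X Y i" "inj_on i (carr X)" "\<And>Z p z. Hom Z X p \<Longrightarrow> z \<in> carr Z \<Longrightarrow> p z \<in> carr X"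
  shows "mono_in Obj Hom X Y i"
  unfolding mono_in_def using assms by (meson inj_onD)

lemma injective_lie_imp_lie_comodule:
  assumes inv: "\<And>k x. tsum (\<Delta> k) (\<lambda>p q. \<phi> (q * x * T p)) = sA (\<epsilon> k) (\<phi> x)"
    and inj: "injective_lie_module TYPE('u::ab_group_add) A M"
  shows "injective_lie_comodule TYPE('u) H A M"
  unfolding injective_lie_comodule_def extends_along_monos_def
proof (intro conjI allI impI)
  show "lie_comodule H A M" using hopf_mod by (simp add: tp_hopf_module_def)
  fix X Y :: "('k, 'a, 'h, 'u) tp_mod" and i f
  assume "lie_comodule H A X \<and> lie_comodule H A Y \<and>
    mono_in (lie_comodule H A) (lie_comodule_hom H) X Y i \<and> lie_comodule_hom H X M f"
  then have X: "lie_comodule H A X" and Y: "lie_comodule H A Y"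
    and mono: "mono_in (lie_comodule H A) (lie_comodule_hom H) X Y i"
    and f: "lie_hom X M f" "colinear H (carr X) (coact X) s V \<rho> f"
    by (auto simp: lie_comodule_hom_def)
  have i: "lie_hom X Y i" "colinear H (carr X) (coact X) (scale Y) (carr Y) (coact Y) i"
    using mono by (auto simp: mono_in_def lie_comodule_hom_def)
  have "mono_in (lie_module A) lie_hom X Y i"
    by (rule mono_in_injI[where Hom=lie_hom, OF i(1) mono_lie_comodule_inj[OF X Y mono]])
      (auto simp: lie_hom_def linear_on_def)
  moreover have "lie_module A X" "lie_module A Y" using X Y by (simp_all add: lie_comodule_def)
  ultimately obtain g where g: "lie_hom Y M g" and gi: "\<forall>x\<in>carr X. g (i x) = f x"
    using inj f(1) unfolding injective_lie_module_def extends_along_monos_def by blast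
  have \<tau>: "right_comodule H (scale X) (carr X) (coact X)" and \<sigma>: "right_comodule H (scale Y) (carr Y) (coact Y)"
    and lactY: "comodule_action H A (scale Y) (carr Y) (coact Y) (lact Y)"
    using X Y by (simp_all add: lie_comodule_iff)
  have lin_g: "linear_on (scale Y) (carr Y) s V g" and hom_g: "\<And>a y. y \<in> carr Y \<Longrightarrow> g (lact Y a y) = lact M a (g y)"
    using g by (auto simp: lie_hom_def)
  let ?G = "avg_map (coact Y) g"
  have "?G (lact Y a y) = lact M a (?G y)" if "y \<in> carr Y" for a y
    by (rule avg_map_equivariant[OF \<sigma> lin_g lactY lact_M _ _ _ that])
      (simp_all add: hom_g lact_act_commute inv)
  then have "lie_comodule_hom H Y M ?G"
    unfolding lie_comodule_hom_def lie_hom_def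
    using avg_map_linear[OF \<sigma> lin_g] avg_map_colinear[OF \<sigma> lin_g] by blast
  moreover have "?G (i x) = f x" if "x \<in> carr X" for x
    by (rule avg_map_extends[OF \<sigma> lin_g \<tau> i(2) f(2)])
      (use f(1) gi that in \<open>auto simp: lie_hom_def linear_on_def\<close>)
  ultimately show "\<exists>g. lie_comodule_hom H Y M g \<and> (\<forall>x\<in>carr X. g (i x) = f x)" by blast
qed

lemma injective_tp_imp_tp_hopf_module:
  assumes inv: "\<And>k x. tsum (\<Delta> k) (\<lambda>p q. \<phi> (q * x * T p)) = sA (\<epsilon> k) (\<phi> x)"
    and inj: "injective_tp_module TYPE('u::ab_group_add) A M"
  shows "injective_tp_hopf_module TYPE('u) H A M"
  unfolding injective_tp_hopf_module_def extends_along_monos_def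
proof (intro conjI allI impI)
  show "tp_hopf_module H A M" by (rule hopf_mod)
  fix X Y :: "('k, 'a, 'h, 'u) tp_mod" and i f
  assume "tp_hopf_module H A X \<and> tp_hopf_module H A Y \<and>
    mono_in (tp_hopf_module H A) (tp_hopf_hom H) X Y i \<and> tp_hopf_hom H X M f"
  then have X: "tp_hopf_module H A X" and Y: "tp_hopf_module H A Y"
    and mono: "mono_in (tp_hopf_module H A) (tp_hopf_hom H) X Y i"
    and f: "tp_hom X M f" "colinear H (carr X) (coact X) s V \<rho> f"
    by (auto simp: tp_hopf_hom_def)
  have i: "tp_hom X Y i" "colinear H (carr X) (coact X) (scale Y) (carr Y) (coact Y) i"
    using mono by (auto simp: mono_in_def tp_hopf_hom_def)
  have "mono_in (tp_module A) tp_hom X Y i"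
    by (rule mono_in_injI[where Hom=tp_hom, OF i(1) mono_tp_hopf_module_inj[OF X Y mono]])
      (auto simp: tp_hom_def lie_hom_def linear_on_def)
  moreover have "tp_module A X" "tp_module A Y" using X Y by (simp_all add: tp_hopf_module_def)
  ultimately obtain g where g: "tp_hom Y M g" and gi: "\<forall>x\<in>carr X. g (i x) = f x"
    using inj f(1) unfolding injective_tp_module_def extends_along_monos_def by blast
  have \<tau>: "right_comodule H (scale X) (carr X) (coact X)" and \<sigma>: "right_comodule H (scale Y) (carr Y) (coact Y)"
    and actY: "comodule_action H A (scale Y) (carr Y) (coact Y) (lact Y)"
      "comodule_action H A (scale Y) (carr Y) (coact Y) (act Y)"
    using X Y by (simp_all add: tp_hopf_module_iff lie_comodule_iff)
  have lin_g: "linear_on (scale Y) (carr Y) s V g"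
    and hom_g: "\<And>a y. y \<in> carr Y \<Longrightarrow> g (lact Y a y) = lact M a (g y)"
      "\<And>a y. y \<in> carr Y \<Longrightarrow> g (act Y a y) = act M a (g y)"
    using g by (auto simp: tp_hom_def lie_hom_def)
  let ?G = "avg_map (coact Y) g"
  have "?G (lact Y a y) = lact M a (?G y)" if "y \<in> carr Y" for a y
    by (rule avg_map_equivariant[OF \<sigma> lin_g actY(1) lact_M _ _ _ that])
      (simp_all add: hom_g lact_act_commute inv)
  moreover have "?G (act Y a y) = act M a (?G y)" if "y \<in> carr Y" for a y
    by (rule avg_map_equivariant[OF \<sigma> lin_g actY(2) act_M _ _ _ that])
      (simp_all add: hom_g act_act_commute inv)
  ultimately have "tp_hopf_hom H Y M ?G"
    unfolding tp_hopf_hom_def tp_hom_def lie_hom_def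
    using avg_map_linear[OF \<sigma> lin_g] avg_map_colinear[OF \<sigma> lin_g] by blast
  moreover have "?G (i x) = f x" if "x \<in> carr X" for x
    by (rule avg_map_extends[OF \<sigma> lin_g \<tau> i(2) f(2)])
      (use f(1) gi that in \<open>auto simp: tp_hom_def lie_hom_def linear_on_def\<close>)
  ultimately show "\<exists>g. tp_hopf_hom H Y M g \<and> (\<forall>x\<in>carr X. g (i x) = f x)" by blast
qed

end

theorem theorem2p4:
  fixes H :: "('k::field_char_0, 'h::ring_1) hopf"
    and A :: "('k, 'a::{comm_ring, comm_monoid_mult}, 'h) tp_alg"
    and M :: "('k, 'a, 'h, 'm::ab_group_add) tp_mod"
    and \<phi> :: "'h \<Rightarrow> 'a"
  assumes "hopf_algebra H" and "bij (antipode H)"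
    and "comodule_tp_algebra H A"
    and "Vector_Spaces.linear (hscale H) (ascale A) \<phi>"
    and "range \<phi> \<subseteq> tp_center A"
    and "colinear H UNIV (comult H) (ascale A) UNIV (acoact A) \<phi>"
    and "\<phi> 1 = 1"
    and "tp_hopf_module H A M"
    and "associative_actions A M"
  shows "((\<forall>x y :: 'h. x * y = y * x) \<or> (\<forall>x y. \<phi> (x * y) = \<phi> x * \<phi> y) \<longrightarrow>
            injective_lie_module TYPE('u::ab_group_add) A M \<longrightarrow>
            injective_lie_comodule TYPE('u) H A M) \<and>
         ((\<forall>x y :: 'h. x * y = y * x) \<longrightarrow>
            injective_tp_module TYPE('u) A M \<longrightarrow>
            injective_tp_hopf_module TYPE('u) H A M)"
proof -
  interpret tp_integral H A M \<phi>
    by (intro tp_integral.intro tp_integral_axioms.intro hopf_alg_bij.intro hopf_alg.intro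
        hopf_alg_bij_axioms.intro assms)
  show ?thesis
    using injective_lie_imp_lie_comodule[OF phi_ad_invariant] injective_tp_imp_tp_hopf_module[OF phi_ad_invariant] by blast
qed

end
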